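(* Let $u_3=\phi(x,u,u_1,u_2)$ be a third-order ODE admitting Lie point symmetries $\mathbf v_1,\mathbf v_2,\mathbf v_3$ which form a basis of a Lie algebra isomorphic to $\mathfrak{sl}(2,\mathbb R)$ with $[\mathbf v_1,\mathbf v_3]=\mathbf v_1$, $[\mathbf v_1,\mathbf v_2]=2\mathbf v_3$, $[\mathbf v_3,\mathbf v_2]=\mathbf v_2$, and let $\mathbf A_{(x,u)}$ be the vector field associated to this ODE. Let $I_1,I_2$ be first integrals, associated to the $\mathcal C^\infty$-symmetries $(\overline{\mathbf v}_1,\lambda_1)$, $(\overline{\mathbf v}_2,\lambda_2)$ respectively, of the second-order equation obtained by reducing the ODE with $\mathbf v_3$ (see context), written in the variables $(x,u,u_1,u_2)$, and put $$F_1=\frac{1}{\mathbf v_1^{(2)}(I_2)},\qquad F_2=\frac1{\mathbf v_2^{(2)}(I_1)} .$$ Then each of the sets $\{I_1,F_1,F_2\}$ and $\{I_2,F_1,F_2\}$ is a complete system of first integrals of $\mathbf A_{(x,u)}$, i.e. consists of three functionally independent functions annihilated by $\mathbf A_{(x,u)}$.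
   Context: All objects are smooth and considered locally, on suitable open sets. Functions are functionally independent if they satisfy no nontrivial functional relation on any open subset (equivalently, their differentials are linearly independent on a dense open subset). $x$ is the independent and $u$ the dependent variable, $u_j=d^ju/dx^j$; $\mathbf v^{(k)}$ is the standard $k$th-order prolongation of a vector field $\mathbf v=\xi(x,u)\partial_x+\eta(x,u)\partial_u$. The vector field associated to the ODE is $\mathbf A_{(x,u)}=\partial_x+u_1\partial_u+u_2\partial_{u_1}+\phi\,\partial_{u_2}$. It is assumed that $\mathbf A_{(x,u)},\mathbf v_1^{(2)},\mathbf v_2^{(2)},\mathbf v_3^{(2)}$ are linearly independent at each point of the open set of $(x,u,u_1,u_2)$-space under consideration. A first integral of the reduced equation is taken to have nowhere vanishing differential. Reduction by $\mathbf v_3$: let $(x,u)\mapsto(y(x,u),\alpha(x,u))$ be a local change of variables in which $\mathbf v_3=\partial_\alpha$. Put $\alpha_i=d^i\alpha/dy^i$, $w=\alpha_1$, $w_i=\alpha_{i+1}$; thus $w=w(x,u,u_1)$ and $w_1=w_1(x,u,u_1,u_2)$. The ODE is then locally written as $w_2=\widetilde\phi(y,w,w_1)$, equivalently $\alpha_3=\widetilde\phi(y,\alpha_1,\alpha_2)$. Put $\mathbf A_{(y,w)}=\partial_y+w_1\partial_w+\widetilde\phi(y,w,w_1)\partial_{w_1}$ and $\mathbf A_{(y,\alpha)}=\partial_y+\alpha_1\partial_\alpha+\alpha_2\partial_{\alpha_1}+\widetilde\phi(y,\alpha_1,\alpha_2)\partial_{\alpha_2}$. $\lambda$-prolongations: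 for $\overline{\mathbf v}=\xi(y,w)\partial_y+\eta(y,w)\partial_w$ and a function $\lambda(y,w,w_1)$, $$\overline{\mathbf v}^{[\lambda,(1)]}=\xi\partial_y+\eta\partial_w+\big((\mathbf D_y+\lambda)(\eta)-(\mathbf D_y+\lambda)(\xi)\,w_1\big)\partial_{w_1},$$ where $\mathbf D_y=\partial_y+w_1\partial_w+\cdots$. The pair $(\overline{\mathbf v},\lambda)$ is a $\mathcal C^\infty$-symmetry of $w_2=\widetilde\phi$ if $[\overline{\mathbf v}^{[\lambda,(1)]},\mathbf A_{(y,w)}]=\lambda\,\overline{\mathbf v}^{[\lambda,(1)]}-(\mathbf A_{(y,w)}+\lambda)(\xi)\,\mathbf A_{(y,w)}$. A first integral associated to $(\overline{\mathbf v},\lambda)$ is a nonconstant function $I(y,w,w_1)$ with $\mathbf A_{(y,w)}(I)=\overline{\mathbf v}^{[\lambda,(1)]}(I)=0$. Inherited $\mathcal C^\infty$-symmetries: choose nowhere zero functions $\varsigma_1,\varsigma_2$ of $(x,u)$ with $\mathbf v_3(\varsigma_1)=\varsigma_1$, $\mathbf v_3(\varsigma_2)=-\varsigma_2$. Then $\varsigma_i\mathbf v_i^{(1)}$ ($i=1,2$) commutes with $\mathbf v_3^{(1)}$, hence projects under $\pi:(y,\alpha,w)\mapsto(y,w)$; put $\overline{\mathbf v}_i=\pi_*(\varsigma_i\mathbf v_i^{(1)})$ and $\lambda_i=-\mathbf A_{(y,\alpha)}(\varsigma_i)/\varsigma_i$. These pairs are $\mathcal C^\infty$-symmetries of the reduced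 equation. Written in $(x,u,u_1,u_2)$, $I_1,I_2$ satisfy $\mathbf A_{(x,u)}(I_1)=\mathbf v_1^{(2)}(I_1)=\mathbf v_3^{(2)}(I_1)=0$ and $\mathbf A_{(x,u)}(I_2)=\mathbf v_2^{(2)}(I_2)=\mathbf v_3^{(2)}(I_2)=0$; hence $\mathbf v_2^{(2)}(I_1)$ and $\mathbf v_1^{(2)}(I_2)$ are nowhere zero, so $F_1,F_2$ are well defined. *)

theory Defs
  imports "HOL-Analysis.Analysis"
begin

text \<open>
  Points of jet spaces are tuples such as \<open>(x, u, u1, u2)\<close>; functions and vector fields are total,
  but only their values on an explicitly given open set matter.  A vector field on a vector space
  \<open>'a\<close> is a map \<open>'a \<Rightarrow> 'a\<close> (its components in the standard frame).
\<close>

primrec Ck_on :: "nat \<Rightarrow> 'a::real_normed_vector set \<Rightarrow> ('a \<Rightarrow> 'b::real_normed_vector) \<Rightarrow> bool" where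
  "Ck_on 0 S f \<longleftrightarrow> continuous_on S f"
| "Ck_on (Suc k) S f \<longleftrightarrow> (\<forall>p\<in>S. f differentiable at p) \<and>
     (\<forall>h. Ck_on k S (\<lambda>p. frechet_derivative f (at p) h))"

definition smooth_on :: "'a::real_normed_vector set \<Rightarrow> ('a \<Rightarrow> 'b::real_normed_vector) \<Rightarrow> bool" where
  "smooth_on S f \<longleftrightarrow> (\<forall>k. Ck_on k S f)"

definition lie_deriv ::
  "('a::real_normed_vector \<Rightarrow> 'a) \<Rightarrow> ('a \<Rightarrow> 'b::real_normed_vector) \<Rightarrow> 'a \<Rightarrow> 'b" where
  "lie_deriv X f p = frechet_derivative f (at p) (X p)"

text \<open>For vector-valued \<open>f\<close>, \<^term>\<open>lie_deriv X f p\<close> is the tangent vector \<open>df\<^sub>p(X\<^sub>p)\<close>.\<close>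

definition lie_bracket ::
  "('a::real_normed_vector \<Rightarrow> 'a) \<Rightarrow> ('a \<Rightarrow> 'a) \<Rightarrow> 'a \<Rightarrow> 'a" where
  "lie_bracket X Y p = lie_deriv X Y p - lie_deriv Y X p"

text \<open>\<open>f\<^sub>* X = Y\<close> on \<open>f ` S\<close>.\<close>

definition pushes_to ::
  "'a::real_normed_vector set \<Rightarrow> ('a \<Rightarrow> 'b::real_normed_vector) \<Rightarrow> ('a \<Rightarrow> 'a) \<Rightarrow> ('b \<Rightarrow> 'b) \<Rightarrow> bool" where
  "pushes_to S f X Y \<longleftrightarrow> (\<forall>p\<in>S. lie_deriv X f p = Y (f p))"

type_synonym R2 = "real \<times> real"
type_synonym R3 = "real \<times> real \<times> real"
type_synonym R4 = "real \<times> real \<times> real \<times> real"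
type_synonym R5 = "real \<times> real \<times> real \<times> real \<times> real"

fun jet0 :: "R4 \<Rightarrow> R2" where "jet0 (x, u, u1, u2) = (x, u)"
fun jet1 :: "R4 \<Rightarrow> R3" where "jet1 (x, u, u1, u2) = (x, u, u1)"

text \<open>Total derivatives: \<open>Dk\<close> maps functions on the jet space of order \<open>k - 1\<close> to functions on
  the one of order \<open>k\<close>.\<close>

fun D1 :: "(R2 \<Rightarrow> real) \<Rightarrow> R3 \<Rightarrow> real" where
  "D1 f (x, u, u1) = frechet_derivative f (at (x, u)) (1, u1)"

fun D2 :: "(R3 \<Rightarrow> real) \<Rightarrow> R4 \<Rightarrow> real" where
  "D2 f (x, u, u1, u2) = frechet_derivative f (at (x, u, u1)) (1, u1, u2)"

fun D3 :: "(R4 \<Rightarrow> real) \<Rightarrow> R5 \<Rightarrow> real" where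
  "D3 f (x, u, u1, u2, u3) = frechet_derivative f (at (x, u, u1, u2)) (1, u1, u2, u3)"

text \<open>Prolongations of \<open>v = \<xi> \<partial>\<^sub>x + \<eta> \<partial>\<^sub>u\<close>, where \<open>\<xi> = fst \<circ> v\<close> and \<open>\<eta> = snd \<circ> v\<close>.\<close>

fun eta1 :: "(R2 \<Rightarrow> R2) \<Rightarrow> R3 \<Rightarrow> real" where
  "eta1 v (x, u, u1) = D1 (snd \<circ> v) (x, u, u1) - u1 * D1 (fst \<circ> v) (x, u, u1)"

fun eta2 :: "(R2 \<Rightarrow> R2) \<Rightarrow> R4 \<Rightarrow> real" where
  "eta2 v (x, u, u1, u2) = D2 (eta1 v) (x, u, u1, u2) - u2 * D1 (fst \<circ> v) (x, u, u1)"

fun eta3 :: "(R2 \<Rightarrow> R2) \<Rightarrow> R5 \<Rightarrow> real" where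
  "eta3 v (x, u, u1, u2, u3) = D3 (eta2 v) (x, u, u1, u2, u3) - u3 * D1 (fst \<circ> v) (x, u, u1)"

fun prol1 :: "(R2 \<Rightarrow> R2) \<Rightarrow> R3 \<Rightarrow> R3" where
  "prol1 v (x, u, u1) = (fst (v (x, u)), snd (v (x, u)), eta1 v (x, u, u1))"

fun prol2 :: "(R2 \<Rightarrow> R2) \<Rightarrow> R4 \<Rightarrow> R4" where
  "prol2 v (x, u, u1, u2) =
     (fst (v (x, u)), snd (v (x, u)), eta1 v (x, u, u1), eta2 v (x, u, u1, u2))"

fun prol3 :: "(R2 \<Rightarrow> R2) \<Rightarrow> R5 \<Rightarrow> R5" where
  "prol3 v (x, u, u1, u2, u3) =
     (fst (v (x, u)), snd (v (x, u)), eta1 v (x, u, u1), eta2 v (x, u, u1, u2),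
      eta3 v (x, u, u1, u2, u3))"

text \<open>Vector fields associated to \<open>u\<^sub>3 = \<phi>(x, u, u\<^sub>1, u\<^sub>2)\<close> and to \<open>w\<^sub>2 = \<psi>(y, w, w\<^sub>1)\<close>.\<close>

fun ode3_field :: "(R4 \<Rightarrow> real) \<Rightarrow> R4 \<Rightarrow> R4" where
  "ode3_field \<phi> (x, u, u1, u2) = (1, u1, u2, \<phi> (x, u, u1, u2))"

fun ode2_field :: "(R3 \<Rightarrow> real) \<Rightarrow> R3 \<Rightarrow> R3" where
  "ode2_field \<psi> (y, w, w1) = (1, w1, \<psi> (y, w, w1))"

text \<open>Infinitesimal invariance: \<open>v\<^sup>(\<^sup>3\<^sup>) (u\<^sub>3 - \<phi>) = 0\<close> whenever \<open>u\<^sub>3 = \<phi>\<close>.\<close>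

definition lie_point_symmetry :: "R4 set \<Rightarrow> (R4 \<Rightarrow> real) \<Rightarrow> (R2 \<Rightarrow> R2) \<Rightarrow> bool" where
  "lie_point_symmetry M \<phi> v \<longleftrightarrow> (\<forall>(x, u, u1, u2) \<in> M.
     lie_deriv (prol3 v) (\<lambda>(x, u, u1, u2, u3). u3 - \<phi> (x, u, u1, u2))
       (x, u, u1, u2, \<phi> (x, u, u1, u2)) = 0)"

definition sl2_basis_on :: "R2 set \<Rightarrow> (R2 \<Rightarrow> R2) \<Rightarrow> (R2 \<Rightarrow> R2) \<Rightarrow> (R2 \<Rightarrow> R2) \<Rightarrow> bool" where
  "sl2_basis_on U v1 v2 v3 \<longleftrightarrow>
     (\<forall>a b c. (\<forall>p\<in>U. a *\<^sub>R v1 p + b *\<^sub>R v2 p + c *\<^sub>R v3 p = 0) \<longrightarrow> a = 0 \<and> b = 0 \<and> c = 0) \<and>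
     (\<forall>p\<in>U. lie_bracket v1 v3 p = v1 p) \<and>
     (\<forall>p\<in>U. lie_bracket v1 v2 p = 2 *\<^sub>R v3 p) \<and>
     (\<forall>p\<in>U. lie_bracket v3 v2 p = v2 p)"

definition lin_indep4 :: "'a::real_vector \<Rightarrow> 'a \<Rightarrow> 'a \<Rightarrow> 'a \<Rightarrow> bool" where
  "lin_indep4 p q r s \<longleftrightarrow> (\<forall>a b c d. a *\<^sub>R p + b *\<^sub>R q + c *\<^sub>R r + d *\<^sub>R s = 0 \<longrightarrow>
     a = 0 \<and> b = 0 \<and> c = 0 \<and> d = 0)"

text \<open>\<open>f : U \<rightarrow> V\<close> is a diffeomorphism between open sets with inverse \<open>g\<close>.\<close>

definition diffeomorphism_between ::
  "'a::real_normed_vector set \<Rightarrow> 'b::real_normed_vector set \<Rightarrow> ('a \<Rightarrow> 'b) \<Rightarrow> ('b \<Rightarrow> 'a) \<Rightarrow> bool" where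
  "diffeomorphism_between U V f g \<longleftrightarrow>
     open U \<and> open V \<and> homeomorphism U V f g \<and> smooth_on U f \<and> smooth_on V g"

text \<open>\<open>\<alpha>\<^sub>i = d\<^sup>i\<alpha>/dy\<^sup>i\<close> as functions on the jet space of order \<open>i\<close> over \<open>(x, u)\<close>;
  thus \<open>w = \<alpha>\<^sub>1\<close> and \<open>w\<^sub>1 = \<alpha>\<^sub>2\<close>.\<close>

fun alpha1 :: "(R2 \<Rightarrow> real) \<Rightarrow> (R2 \<Rightarrow> real) \<Rightarrow> R3 \<Rightarrow> real" where
  "alpha1 y \<alpha> (x, u, u1) = D1 \<alpha> (x, u, u1) / D1 y (x, u, u1)"

fun alpha2 :: "(R2 \<Rightarrow> real) \<Rightarrow> (R2 \<Rightarrow> real) \<Rightarrow> R4 \<Rightarrow> real" where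
  "alpha2 y \<alpha> (x, u, u1, u2) = D2 (alpha1 y \<alpha>) (x, u, u1, u2) / D1 y (x, u, u1)"

fun alpha3 :: "(R2 \<Rightarrow> real) \<Rightarrow> (R2 \<Rightarrow> real) \<Rightarrow> R5 \<Rightarrow> real" where
  "alpha3 y \<alpha> (x, u, u1, u2, u3) = D3 (alpha2 y \<alpha>) (x, u, u1, u2, u3) / D1 y (x, u, u1)"

text \<open>The change of variables in the prolonged coordinates, \<open>(x, u, u\<^sub>1) \<mapsto> (y, \<alpha>, w)\<close> and
  \<open>(x, u, u\<^sub>1, u\<^sub>2) \<mapsto> (y, \<alpha>, \<alpha>\<^sub>1, \<alpha>\<^sub>2)\<close>, and the map to the reduced variables \<open>(y, w, w\<^sub>1)\<close>.\<close>

fun coords1 :: "(R2 \<Rightarrow> real) \<Rightarrow> (R2 \<Rightarrow> real) \<Rightarrow> R3 \<Rightarrow> R3" where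
  "coords1 y \<alpha> (x, u, u1) = (y (x, u), \<alpha> (x, u), alpha1 y \<alpha> (x, u, u1))"

fun coords2 :: "(R2 \<Rightarrow> real) \<Rightarrow> (R2 \<Rightarrow> real) \<Rightarrow> R4 \<Rightarrow> R4" where
  "coords2 y \<alpha> (x, u, u1, u2) =
     (y (x, u), \<alpha> (x, u), alpha1 y \<alpha> (x, u, u1), alpha2 y \<alpha> (x, u, u1, u2))"

fun drop_alpha1 :: "R3 \<Rightarrow> R2" where "drop_alpha1 (y, \<alpha>, w) = (y, w)"
fun drop_alpha2 :: "R4 \<Rightarrow> R3" where "drop_alpha2 (y, \<alpha>, w, w1) = (y, w, w1)"

definition reduced_vars :: "(R2 \<Rightarrow> real) \<Rightarrow> (R2 \<Rightarrow> real) \<Rightarrow> R4 \<Rightarrow> R3" where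
  "reduced_vars y \<alpha> = drop_alpha2 \<circ> coords2 y \<alpha>"

text \<open>On the open set \<open>M\<close>, the equation \<open>u\<^sub>3 = \<phi>\<close> reads \<open>\<alpha>\<^sub>3 = \<psi>(y, \<alpha>\<^sub>1, \<alpha>\<^sub>2)\<close> in variables \<open>(y, \<alpha>)\<close>
  with \<open>v = \<partial>\<^sub>\<alpha>\<close>; \<open>N\<close> is the domain of the reduced equation \<open>w\<^sub>2 = \<psi>(y, w, w\<^sub>1)\<close>, and \<open>g\<close>
  recovers \<open>(x, u)\<close> from \<open>(y, \<alpha>)\<close>.  The quotients defining \<open>\<alpha>\<^sub>i\<close> need \<open>dy/dx \<noteq> 0\<close>.\<close>

definition reduction ::
  "R2 set \<Rightarrow> R4 set \<Rightarrow> (R4 \<Rightarrow> real) \<Rightarrow> (R2 \<Rightarrow> R2) \<Rightarrow>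
   R2 set \<Rightarrow> (R2 \<Rightarrow> real) \<Rightarrow> (R2 \<Rightarrow> real) \<Rightarrow> (R2 \<Rightarrow> R2) \<Rightarrow> R3 set \<Rightarrow> (R3 \<Rightarrow> real) \<Rightarrow> bool" where
  "reduction U M \<phi> v V y \<alpha> g N \<psi> \<longleftrightarrow>
     diffeomorphism_between U V (\<lambda>p. (y p, \<alpha> p)) g \<and>
     pushes_to U (\<lambda>p. (y p, \<alpha> p)) v (\<lambda>_. (0, 1)) \<and>
     (\<forall>p\<in>M. D1 y (jet1 p) \<noteq> 0) \<and>
     open N \<and> N = reduced_vars y \<alpha> ` M \<and> smooth_on N \<psi> \<and>
     (\<forall>(x, u, u1, u2) \<in> M. alpha3 y \<alpha> (x, u, u1, u2, \<phi> (x, u, u1, u2)) =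
        \<psi> (reduced_vars y \<alpha> (x, u, u1, u2)))"

text \<open>The pair \<open>(vb, l)\<close> inherited from \<open>v\<close> through the function \<open>s\<close>: \<open>vb = \<pi>\<^sub>* (s v\<^sup>(\<^sup>1\<^sup>))\<close> and
  \<open>l = - A(s) / s\<close>, where \<open>A\<close> is the field of \<open>\<alpha>\<^sub>3 = \<psi>(y, \<alpha>\<^sub>1, \<alpha>\<^sub>2)\<close> and \<open>s\<close> is written in the
  variables \<open>(y, \<alpha>)\<close> as \<open>s \<circ> g\<close>.\<close>

definition inherited_pair ::
  "R4 set \<Rightarrow> (R2 \<Rightarrow> real) \<Rightarrow> (R2 \<Rightarrow> real) \<Rightarrow> (R2 \<Rightarrow> R2) \<Rightarrow> R3 set \<Rightarrow> (R3 \<Rightarrow> real) \<Rightarrow>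
   (R2 \<Rightarrow> R2) \<Rightarrow> (R2 \<Rightarrow> real) \<Rightarrow> (R2 \<Rightarrow> R2) \<Rightarrow> (R3 \<Rightarrow> real) \<Rightarrow> bool" where
  "inherited_pair M y \<alpha> g N \<psi> v s vb l \<longleftrightarrow>
     smooth_on ((\<lambda>(y, w, w1). (y, w)) ` N) vb \<and> smooth_on N l \<and>
     pushes_to (jet1 ` M) (drop_alpha1 \<circ> coords1 y \<alpha>)
       (\<lambda>(x, u, u1). s (x, u) *\<^sub>R prol1 v (x, u, u1)) vb \<and>
     (\<forall>p\<in>M. l (reduced_vars y \<alpha> p) =
        - lie_deriv (ode3_field (\<psi> \<circ> drop_alpha2)) (s \<circ> g \<circ> jet0) (coords2 y \<alpha> p)
        / (s \<circ> g \<circ> jet0) (coords2 y \<alpha> p))"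

text \<open>First-order \<open>\<lambda>\<close>-prolongation of a vector field in \<open>(y, w)\<close>, with \<open>l\<close> for \<open>\<lambda>\<close>.\<close>

fun lambda_prol1 :: "(R2 \<Rightarrow> R2) \<Rightarrow> (R3 \<Rightarrow> real) \<Rightarrow> R3 \<Rightarrow> R3" where
  "lambda_prol1 v l (y, w, w1) =
     (fst (v (y, w)), snd (v (y, w)),
      (D1 (snd \<circ> v) (y, w, w1) + l (y, w, w1) * snd (v (y, w)))
      - (D1 (fst \<circ> v) (y, w, w1) + l (y, w, w1) * fst (v (y, w))) * w1)"

text \<open>First integral of \<open>w\<^sub>2 = \<psi>\<close> associated to \<open>(v, l)\<close>; nonconstancy is required in the form
  of a nowhere vanishing differential.\<close>

definition assoc_first_integral ::
  "R3 set \<Rightarrow> (R3 \<Rightarrow> real) \<Rightarrow> (R2 \<Rightarrow> R2) \<Rightarrow> (R3 \<Rightarrow> real) \<Rightarrow> (R3 \<Rightarrow> real) \<Rightarrow> bool" where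
  "assoc_first_integral N \<psi> v l I \<longleftrightarrow>
     smooth_on N I \<and>
     (\<forall>q\<in>N. frechet_derivative I (at q) \<noteq> (\<lambda>_. 0)) \<and>
     (\<forall>q\<in>N. lie_deriv (ode2_field \<psi>) I q = 0) \<and>
     (\<forall>q\<in>N. lie_deriv (lambda_prol1 v l) I q = 0)"

text \<open>The components of \<open>f\<close> satisfy no nontrivial functional relation \<open>G(f) = 0\<close> on any nonempty
  open subset.  Nontrivial means that \<open>G\<close> vanishes identically on no nonempty open subset of its
  domain: otherwise a \<open>G\<close> supported away from the values of \<open>f\<close> would count as a relation.\<close>

definition functionally_independent_on ::
  "'a::euclidean_space set \<Rightarrow> ('a \<Rightarrow> 'b::euclidean_space) \<Rightarrow> bool" where
  "functionally_independent_on S f \<longleftrightarrow>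
     \<not> (\<exists>B W (G :: 'b \<Rightarrow> real). open B \<and> B \<noteq> {} \<and> B \<subseteq> S \<and> open W \<and> f ` B \<subseteq> W \<and> smooth_on W G \<and>
          (\<forall>W'. open W' \<and> W' \<noteq> {} \<and> W' \<subseteq> W \<longrightarrow> (\<exists>z\<in>W'. G z \<noteq> 0)) \<and>
          (\<forall>p\<in>B. G (f p) = 0))"

definition complete_system ::
  "R4 set \<Rightarrow> (R4 \<Rightarrow> R4) \<Rightarrow> (R4 \<Rightarrow> real) \<Rightarrow> (R4 \<Rightarrow> real) \<Rightarrow> (R4 \<Rightarrow> real) \<Rightarrow> bool" where
  "complete_system M X f1 f2 f3 \<longleftrightarrow>
     (\<forall>f\<in>{f1, f2, f3}. smooth_on M f \<and> (\<forall>p\<in>M. lie_deriv X f p = 0)) \<and>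
     functionally_independent_on M (\<lambda>p. (f1 p, f2 p, f3 p))"

end

theory Submission
  imports Defs
begin

text \<open>
  Write \<open>X\<^sub>i\<close> for the second prolongation of \<open>v\<^sub>i\<close> and \<open>A\<close> for the field of the equation.  Prolongation
  respects brackets, and \<open>[X\<^sub>i, A]\<close> is a multiple of \<open>A\<close>.  Since \<open>A\<close>, \<open>X\<^sub>1\<close> and \<open>X\<^sub>3\<close> annihilate \<open>J\<^sub>1\<close>, the
  commutation relations show that \<open>f = X\<^sub>2 J\<^sub>1\<close> satisfies \<open>A f = X\<^sub>1 f = 0\<close> and \<open>X\<^sub>3 f = f\<close>; symmetrically
  \<open>h = X\<^sub>1 J\<^sub>2\<close> satisfies \<open>A h = X\<^sub>2 h = 0\<close> and \<open>X\<^sub>3 h = - h\<close>.  Along \<open>X\<^sub>1, X\<^sub>2, X\<^sub>3\<close> the Jacobians of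
  \<open>(J\<^sub>1, 1/h, 1/f)\<close> and \<open>(J\<^sub>2, 1/h, 1/f)\<close> are then triangular up to order, with determinants nonzero
  multiples of \<open>X\<^sub>1 h\<close> and \<open>X\<^sub>2 f\<close>.  Neither of these can vanish on a nonempty open set:
  \<open>X\<^sub>1 h = X\<^sub>2 h = 0\<close> would give \<open>0 = [X\<^sub>1, X\<^sub>2] h = 2 X\<^sub>3 h = - 2 h\<close>.  A map with surjective differential
  at some point of every open set satisfies no functional relation, because its images of open sets
  have interior points.
\<close>

section \<open>Smooth functions and the symmetry of second derivatives\<close>

text \<open>That \<open>J1\<close> and \<open>J2\<close> are killed by \<open>A\<close>,
  \<open>X3\<close> and their own \<open>Xi\<close> is derived from the reduction. The map to
  \<open>(y, w, w1)\<close> carries \<open>A\<close> to a multiple of the reduced field, kills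
  \<open>X3\<close>, and carries \<open>s\<close> times \<open>Xi\<close> to the
  \<lambda>-prolongation: \<lambda> = - A(s)/s is exactly the logarithmic term left over when the
  factor \<open>s\<close> is moved through D_y. Since that map is a submersion, dJ1 never vanishes;
  it already kills three of the four frame fields, so \<open>f\<close> has no zeros, and likewise
  \<open>h\<close>. For \<open>X1 h\<close> and \<open>X2 f\<close> the argument excludes only open
  sets of zeros, which is why independence is checked at one suitable point of each open set. The
  commutation rules for total derivatives and for iterated Lie derivatives come from one identity,
  which differentiates df at a moving point in a moving direction. All objects are total functions
  whose relations hold only on open sets, so relations are transferred by local congruence before
  they are differentiated.\<close>

lemma Ck_on_subset: "Ck_on k S f \<Longrightarrow> T \<subseteq> S \<Longrightarrow> Ck_on k T f"
proof (induction k arbitrary: f)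
  case 0
  then show ?case by (auto intro: continuous_on_subset)
qed (auto)

text \<open>Openness matters: derivatives at \<open>p\<close> depend on values near
  \<open>p\<close>, so equality on \<open>S\<close> passes to derivatives because \<open>S\<close>
  is a neighbourhood of each of its points.\<close>

lemma Ck_on_cong:
  assumes "open S" "\<And>p. p \<in> S \<Longrightarrow> f p = g p" "Ck_on k S f"
  shows "Ck_on k S g"
  using assms(2,3)
proof (induction k arbitrary: f g)
  case 0
  then show ?case by (simp cong: continuous_on_cong)
next
  case (Suc k)
  have "g differentiable at p \<and> frechet_derivative f (at p) = frechet_derivative g (at p)" if "p \<in> S" for p
  proof -
    have "(f has_derivative frechet_derivative f (at p)) (at p)"
      using Suc.prems(2) that frechet_derivative_works by (metis Ck_on.simps(2))
    then have "(g has_derivative frechet_derivative f (at p)) (at p)"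
      by (rule has_derivative_transform_within_open[OF _ assms(1) that]) (use Suc.prems in auto)
    then show ?thesis
      using differentiableI frechet_derivative_at by blast
  qed
  moreover have "Ck_on k S (\<lambda>p. frechet_derivative g (at p) h)" for h
    by (rule Suc.IH[where f = "\<lambda>p. frechet_derivative f (at p) h"])
      (use Suc.prems(2) calculation in auto)
  ultimately show ?case by simp
qed

lemma Ck_on_SucI:
  assumes "open S" "\<And>p. p \<in> S \<Longrightarrow> (f has_derivative f' p) (at p)"
    and "\<And>h. Ck_on k S (\<lambda>p. f' p h)"
  shows "Ck_on (Suc k) S f"
proof -
  have "frechet_derivative f (at p) = f' p" if "p \<in> S" for p
    using assms(2)[OF that] frechet_derivative_at by metis
  then have "Ck_on k S (\<lambda>p. frechet_derivative f (at p) h)" for h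
    by (intro Ck_on_cong[OF assms(1) _ assms(3)[of h]]) auto
  then show ?thesis
    using assms(2) unfolding Ck_on.simps differentiable_def by blast
qed

lemma Ck_on_Suc_has_derivative:
  assumes "Ck_on (Suc k) S f" "p \<in> S"
  shows "(f has_derivative frechet_derivative f (at p)) (at p)"
  using assms frechet_derivative_works by (metis Ck_on.simps(2))

lemma Ck_on_SucD: "Ck_on (Suc k) S f \<Longrightarrow> Ck_on k S f"
proof (induction k arbitrary: f)
  case 0
  then have "\<forall>p\<in>S. isCont f p"
    by (auto intro: differentiable_imp_continuous_within)
  then show ?case by (simp add: continuous_at_imp_continuous_on)
qed auto

lemma Ck_on_const: "Ck_on k S (\<lambda>p. c)"
  by (induction k arbitrary: c) auto

lemma Ck_on_bounded_linear_compose: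
  assumes "open S" "bounded_linear L" "Ck_on k S f"
  shows "Ck_on k S (\<lambda>p. L (f p))"
  using assms(3)
proof (induction k arbitrary: f)
  case 0
  then show ?case
    using assms(2) by (simp add: bounded_linear.continuous_on)
next
  case (Suc k)
  show ?case
  proof (rule Ck_on_SucI[OF assms(1)])
    show "((\<lambda>p. L (f p)) has_derivative (\<lambda>h. L (frechet_derivative f (at p) h))) (at p)"
      if "p \<in> S" for p
      by (rule bounded_linear.has_derivative[OF assms(2) Ck_on_Suc_has_derivative[OF Suc.prems that]])
  qed (use Suc in auto)
qed

lemma Ck_on_ident: "Ck_on k S (\<lambda>p. p)"
  by (cases k) (auto simp: Ck_on_const)

lemma Ck_on_add:
  assumes "open S" "Ck_on k S f" "Ck_on k S g"
  shows "Ck_on k S (\<lambda>p. f p + g p)"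
  using assms(2,3)
proof (induction k arbitrary: f g)
  case 0
  then show ?case by (simp add: continuous_on_add)
next
  case (Suc k)
  show ?case
  proof (rule Ck_on_SucI[OF assms(1)])
    show "((\<lambda>p. f p + g p) has_derivative
        (\<lambda>h. frechet_derivative f (at p) h + frechet_derivative g (at p) h)) (at p)" if "p \<in> S" for p
      using Suc.prems that by (intro has_derivative_add Ck_on_Suc_has_derivative)
  qed (use Suc in auto)
qed

lemma Ck_on_sum:
  assumes "open S" "\<And>i. i \<in> I \<Longrightarrow> Ck_on k S (f i)"
  shows "Ck_on k S (\<lambda>p. \<Sum>i\<in>I. f i p)"
  using assms(2)
  by (induction I rule: infinite_finite_induct)
    (auto intro!: Ck_on_add[OF assms(1)] simp: Ck_on_const)

lemma Ck_on_bounded_bilinear: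
  assumes "open S" "bounded_bilinear B" "Ck_on k S f" "Ck_on k S g"
  shows "Ck_on k S (\<lambda>p. B (f p) (g p))"
  using assms(3,4)
proof (induction k arbitrary: f g)
  case 0
  then show ?case
    by (simp add: bounded_bilinear.continuous_on[OF assms(2)])
next
  case (Suc k)
  show ?case
  proof (rule Ck_on_SucI[OF assms(1)])
    show "((\<lambda>p. B (f p) (g p)) has_derivative
        (\<lambda>h. B (f p) (frechet_derivative g (at p) h) + B (frechet_derivative f (at p) h) (g p))) (at p)"
      if "p \<in> S" for p
      using Suc.prems that
      by (intro bounded_bilinear.FDERIV[OF assms(2)] Ck_on_Suc_has_derivative)
    show "Ck_on k S (\<lambda>p. B (f p) (frechet_derivative g (at p) h) +
        B (frechet_derivative f (at p) h) (g p))" for h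
      using Suc.prems Ck_on_SucD[OF Suc.prems(1)] Ck_on_SucD[OF Suc.prems(2)]
      by (intro Ck_on_add[OF assms(1)] Suc.IH) auto
  qed
qed

text \<open>\<open>Ck_on\<close> speaks only of derivatives in a fixed direction; expanding a
  direction that varies with the point over the basis reduces it to those.\<close>

lemma frechet_derivative_linear_sum:
  fixes f :: "'a::euclidean_space \<Rightarrow> 'b::real_normed_vector"
  assumes "f differentiable at p"
  shows "frechet_derivative f (at p) h = (\<Sum>b\<in>Basis. (h \<bullet> b) *\<^sub>R frechet_derivative f (at p) b)"
proof -
  interpret linear "frechet_derivative f (at p)"
    using assms by (rule linear_frechet_derivative)
  have "frechet_derivative f (at p) (\<Sum>b\<in>Basis. (h \<bullet> b) *\<^sub>R b) =
      (\<Sum>b\<in>Basis. (h \<bullet> b) *\<^sub>R frechet_derivative f (at p) b)"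
    by (subst sum, subst scale) (rule refl)
  then show ?thesis by (subst (asm) euclidean_representation)
qed

text \<open>By the chain rule the derivative of the composite differentiates \<open>g\<close> in a
  moving direction. Basis expansion of the middle space turns it into a sum of products, to which
  the bilinear rule and the induction hypothesis for fixed-direction derivatives of \<open>g\<close>
  apply.\<close>

lemma Ck_on_compose:
  fixes f :: "'a::real_normed_vector \<Rightarrow> 'b::euclidean_space"
    and g :: "'b \<Rightarrow> 'c::real_normed_vector"
  assumes "open S" "Ck_on k T g" "Ck_on k S f" "f ` S \<subseteq> T"
  shows "Ck_on k S (\<lambda>p. g (f p))"
  using assms(2,3)
proof (induction k arbitrary: g)
  case 0
  then show ?case
    using continuous_on_compose2 assms(4) by auto
next
  case (Suc k)
  show ?case
  proof (rule Ck_on_SucI[OF assms(1)])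
    show "((\<lambda>p. g (f p)) has_derivative
        (\<lambda>h. \<Sum>b\<in>Basis. (frechet_derivative f (at p) h \<bullet> b) *\<^sub>R
          frechet_derivative g (at (f p)) b)) (at p)"
      if "p \<in> S" for p
    proof -
      have g: "g differentiable at (f p)"
        using that Suc.prems assms(4) by auto
      have "((\<lambda>p. g (f p)) has_derivative
        (\<lambda>h. frechet_derivative g (at (f p)) (frechet_derivative f (at p) h))) (at p)"
        by (rule has_derivative_compose[OF Ck_on_Suc_has_derivative[OF Suc.prems(2) that]
              frechet_derivative_works[THEN iffD1, OF g]])
      moreover have "(\<lambda>h. frechet_derivative g (at (f p)) (frechet_derivative f (at p) h)) =
          (\<lambda>h. \<Sum>b\<in>Basis. (frechet_derivative f (at p) h \<bullet> b) *\<^sub>R frechet_derivative g (at (f p)) b)"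
        by (intro ext frechet_derivative_linear_sum[OF g])
      ultimately show ?thesis by (simp only:)
    qed
    show "Ck_on k S (\<lambda>p. \<Sum>b\<in>Basis. (frechet_derivative f (at p) h \<bullet> b) *\<^sub>R
          frechet_derivative g (at (f p)) b)" for h
    proof (intro Ck_on_sum Ck_on_bounded_bilinear[OF _ bounded_bilinear_scaleR] assms(1))
      show "Ck_on k S (\<lambda>p. frechet_derivative f (at p) h \<bullet> b)" for b
        using Suc.prems(2)
        by (intro Ck_on_bounded_linear_compose[OF assms(1) bounded_linear_inner_left]) auto
      show "Ck_on k S (\<lambda>p. frechet_derivative g (at (f p)) b)" for b
        using Suc.prems Ck_on_SucD[OF Suc.prems(2)] by (intro Suc.IH) auto
    qed
  qed
qed

text \<open>For fixed \<open>h\<close> the derivative of \<open>inverse\<close> is a polynomial in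
  \<open>inverse\<close> itself, so the induction closes.\<close>

lemma Ck_on_inverse: "Ck_on k (- {0}) (inverse :: real \<Rightarrow> real)"
proof (induction k)
  case 0
  show ?case by (simp add: continuous_on_inverse)
next
  case (Suc k)
  have o: "open (- {0::real})" by auto
  show ?case
  proof (rule Ck_on_SucI[OF o])
    show "(inverse has_derivative (\<lambda>h. - (inverse p * h * inverse p))) (at p)"
      if "p \<in> - {0}" for p :: real
      using that has_derivative_inverse'[of p UNIV] by auto
    show "Ck_on k (- {0}) (\<lambda>p::real. - (inverse p * h * inverse p))" for h
      by (intro Ck_on_bounded_linear_compose[OF o bounded_linear_minus[OF bounded_linear_ident]]
          Ck_on_bounded_bilinear[OF o bounded_bilinear_mult] Ck_on_const Suc)
  qed
qed

section \<open>Closure properties of smooth maps\<close>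

lemma smooth_on_subset: "smooth_on S f \<Longrightarrow> T \<subseteq> S \<Longrightarrow> smooth_on T f"
  unfolding smooth_on_def by (blast intro: Ck_on_subset)

lemma smooth_on_cong:
  "open S \<Longrightarrow> (\<And>p. p \<in> S \<Longrightarrow> f p = g p) \<Longrightarrow> smooth_on S f \<Longrightarrow> smooth_on S g"
  unfolding smooth_on_def by (blast intro: Ck_on_cong)

lemma smooth_on_const: "smooth_on S (\<lambda>p. c)"
  by (simp add: smooth_on_def Ck_on_const)

lemma smooth_on_ident: "smooth_on S (\<lambda>p. p)"
  by (simp add: smooth_on_def Ck_on_ident)

lemma smooth_on_bounded_linear_compose:
  "open S \<Longrightarrow> bounded_linear L \<Longrightarrow> smooth_on S f \<Longrightarrow> smooth_on S (\<lambda>p. L (f p))"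
  by (simp add: smooth_on_def Ck_on_bounded_linear_compose)

lemmas smooth_on_fst = smooth_on_bounded_linear_compose[OF _ bounded_linear_fst]
lemmas smooth_on_snd = smooth_on_bounded_linear_compose[OF _ bounded_linear_snd]

lemma smooth_on_add:
  "open S \<Longrightarrow> smooth_on S f \<Longrightarrow> smooth_on S g \<Longrightarrow> smooth_on S (\<lambda>p. f p + g p)"
  by (simp add: smooth_on_def Ck_on_add)

lemma smooth_on_mult:
  fixes f g :: "'a::real_normed_vector \<Rightarrow> real"
  shows "open S \<Longrightarrow> smooth_on S f \<Longrightarrow> smooth_on S g \<Longrightarrow> smooth_on S (\<lambda>p. f p * g p)"
  by (simp add: smooth_on_def Ck_on_bounded_bilinear[OF _ bounded_bilinear_mult])

lemma smooth_on_diff: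
  assumes "open S" "smooth_on S f" "smooth_on S g"
  shows "smooth_on S (\<lambda>p. f p - g p)"
  using smooth_on_add[OF assms(1,2) smooth_on_bounded_linear_compose[OF assms(1) bounded_linear_minus[OF bounded_linear_ident] assms(3)]]
  by simp

lemma smooth_on_Pair:
  assumes "open S" "smooth_on S f" "smooth_on S g"
  shows "smooth_on S (\<lambda>p. (f p, g p))"
proof -
  have "smooth_on S (\<lambda>p. (f p, 0) + (0, g p))"
    using bounded_linear_Pair[OF bounded_linear_ident bounded_linear_zero]
      bounded_linear_Pair[OF bounded_linear_zero bounded_linear_ident]
    by (intro smooth_on_add smooth_on_bounded_linear_compose[OF assms(1) _ assms(2)]
        smooth_on_bounded_linear_compose[OF assms(1) _ assms(3)] assms(1))
  then show ?thesis by simp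
qed

lemma smooth_on_compose:
  fixes f :: "'a::real_normed_vector \<Rightarrow> 'b::euclidean_space"
    and g :: "'b \<Rightarrow> 'c::real_normed_vector"
  shows "open S \<Longrightarrow> smooth_on T g \<Longrightarrow> smooth_on S f \<Longrightarrow> f ` S \<subseteq> T \<Longrightarrow> smooth_on S (\<lambda>p. g (f p))"
  unfolding smooth_on_def by (blast intro: Ck_on_compose)

lemma smooth_on_divide:
  fixes f g :: "'a::real_normed_vector \<Rightarrow> real"
  assumes "open S" "smooth_on S f" "smooth_on S g" "\<And>p. p \<in> S \<Longrightarrow> g p \<noteq> 0"
  shows "smooth_on S (\<lambda>p. f p / g p)"
proof -
  have "smooth_on (- {0}) (inverse :: real \<Rightarrow> real)"
    by (simp add: smooth_on_def Ck_on_inverse)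
  then have "smooth_on S (\<lambda>p. f p * inverse (g p))"
    by (intro smooth_on_mult assms smooth_on_compose[of S "- {0}" inverse g]) (use assms(4) in auto)
  then show ?thesis by (simp add: divide_inverse)
qed

lemma smooth_on_differentiable: "smooth_on S f \<Longrightarrow> p \<in> S \<Longrightarrow> f differentiable at p"
  unfolding smooth_on_def by (metis Ck_on.simps(2))

lemma smooth_on_has_derivative:
  "smooth_on S f \<Longrightarrow> p \<in> S \<Longrightarrow> (f has_derivative frechet_derivative f (at p)) (at p)"
  using smooth_on_differentiable frechet_derivative_works by blast

lemma smooth_on_continuous_on: "smooth_on S f \<Longrightarrow> continuous_on S f"
  unfolding smooth_on_def by (metis Ck_on.simps(1))

lemma smooth_on_frechet_derivative: "smooth_on S f \<Longrightarrow> smooth_on S (\<lambda>p. frechet_derivative f (at p) h)"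
  unfolding smooth_on_def by (metis Ck_on.simps(2))

text \<open>The common shape of \<open>lie_deriv\<close>, \<open>D1\<close> and \<open>D2\<close>:
  both the foot point, through \<open>P\<close>, and the direction \<open>E\<close> of
  differentiation vary.\<close>

lemma smooth_on_directional_derivative:
  fixes f :: "'b::euclidean_space \<Rightarrow> real" and P :: "'a::euclidean_space \<Rightarrow> 'b"
  assumes "open S" "smooth_on T f" "smooth_on S P" "P ` S \<subseteq> T" "smooth_on S E"
  shows "smooth_on S (\<lambda>p. frechet_derivative f (at (P p)) (E p))"
proof -
  have "smooth_on S (\<lambda>p. \<Sum>b\<in>Basis. (E p \<bullet> b) * frechet_derivative f (at (P p)) b)"
    unfolding smooth_on_def
  proof (intro allI Ck_on_sum Ck_on_bounded_bilinear[OF _ bounded_bilinear_mult] assms(1))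
    show "Ck_on k S (\<lambda>p. E p \<bullet> b)" for k b
      using assms(5)
      by (intro Ck_on_bounded_linear_compose[OF assms(1) bounded_linear_inner_left]) (auto simp: smooth_on_def)
    show "Ck_on k S (\<lambda>p. frechet_derivative f (at (P p)) b)" for k b
      using smooth_on_compose[OF assms(1) smooth_on_frechet_derivative[OF assms(2)] assms(3,4)]
      by (simp add: smooth_on_def)
  qed
  then show ?thesis
  proof (rule smooth_on_cong[OF assms(1), rotated])
    fix p assume "p \<in> S"
    then have "f differentiable at (P p)"
      using assms(2,4) smooth_on_differentiable by blast
    from frechet_derivative_linear_sum[OF this, of "E p"]
    show "(\<Sum>b\<in>Basis. (E p \<bullet> b) * frechet_derivative f (at (P p)) b) = frechet_derivative f (at (P p)) (E p)"
      by simp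
  qed
qed

section \<open>Symmetry of second derivatives\<close>

lemma second_difference_quotient:
  fixes f :: "'a::real_normed_vector \<Rightarrow> real"
  assumes "Ck_on 2 S f" "0 < t"
    and "\<And>a b. 0 \<le> a \<Longrightarrow> a \<le> t \<Longrightarrow> 0 \<le> b \<Longrightarrow> b \<le> t \<Longrightarrow> p + a *\<^sub>R h + b *\<^sub>R k \<in> S"
  obtains a b where "0 \<le> a" "a \<le> t" "0 \<le> b" "b \<le> t"
    "f (p + t *\<^sub>R h + t *\<^sub>R k) - f (p + t *\<^sub>R h) - f (p + t *\<^sub>R k) + f p =
      t * t * frechet_derivative (\<lambda>q. frechet_derivative f (at q) h) (at (p + a *\<^sub>R h + b *\<^sub>R k)) k"
proof -
  let ?f1 = "\<lambda>q. frechet_derivative f (at q) h"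
  have C: "Ck_on (Suc (Suc 0)) S f" using assms(1) by (simp add: numeral_2_eq_2)
  have D1: "((\<lambda>s. f (p + s *\<^sub>R h + b *\<^sub>R k)) has_real_derivative ?f1 (p + s *\<^sub>R h + b *\<^sub>R k)) (at s)"
    if "p + s *\<^sub>R h + b *\<^sub>R k \<in> S" for s b
  proof -
    have "(f has_derivative frechet_derivative f (at (p + s *\<^sub>R h + b *\<^sub>R k))) (at (p + s *\<^sub>R h + b *\<^sub>R k))"
      using Ck_on_Suc_has_derivative[OF C that] .
    then have "((\<lambda>s. f (p + s *\<^sub>R h + b *\<^sub>R k)) has_derivative
        (\<lambda>r. frechet_derivative f (at (p + s *\<^sub>R h + b *\<^sub>R k)) (r *\<^sub>R h))) (at s)"
      by (intro has_derivative_compose[of "\<lambda>s. p + s *\<^sub>R h + b *\<^sub>R k", where g = f])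
        (auto intro!: derivative_eq_intros)
    moreover have "linear (frechet_derivative f (at (p + s *\<^sub>R h + b *\<^sub>R k)))"
      using C that by (intro linear_frechet_derivative) auto
    ultimately show ?thesis
      by (simp add: has_field_derivative_def linear_cmul mult_commute_abs)
  qed
  have D2: "((\<lambda>r. ?f1 (p + s *\<^sub>R h + r *\<^sub>R k)) has_real_derivative
      frechet_derivative ?f1 (at (p + s *\<^sub>R h + b *\<^sub>R k)) k) (at b)"
    if "p + s *\<^sub>R h + b *\<^sub>R k \<in> S" for s b
  proof -
    have d: "?f1 differentiable at (p + s *\<^sub>R h + b *\<^sub>R k)"
      using C that by auto
    then have "((\<lambda>r. ?f1 (p + s *\<^sub>R h + r *\<^sub>R k)) has_derivative
        (\<lambda>r. frechet_derivative ?f1 (at (p + s *\<^sub>R h + b *\<^sub>R k)) (r *\<^sub>R k))) (at b)"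
      by (intro has_derivative_compose[of "\<lambda>r. p + s *\<^sub>R h + r *\<^sub>R k", where g = ?f1]
          frechet_derivative_works[THEN iffD1]) (auto intro!: derivative_eq_intros)
    with linear_frechet_derivative[OF d] show ?thesis
      by (simp add: has_field_derivative_def linear_cmul mult_commute_abs)
  qed
  \<comment> \<open>The difference in direction \<open>k\<close>, as a function of the step along
    \<open>h\<close>. The term \<open>0 *\<^sub>R k\<close> gives both parts the shape required by
    \<open>D1\<close>.\<close>
  let ?F = "\<lambda>s. f (p + s *\<^sub>R h + t *\<^sub>R k) - f (p + s *\<^sub>R h + 0 *\<^sub>R k)"
  have "\<exists>a>0. a < t \<and> ?F t - ?F 0 = (t - 0) * (?f1 (p + a *\<^sub>R h + t *\<^sub>R k) - ?f1 (p + a *\<^sub>R h + 0 *\<^sub>R k))"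
    using assms(2,3) assms(3)[of _ 0] by (intro MVT2 DERIV_diff D1) auto
  then obtain a where a: "0 < a" "a < t"
    "?F t - ?F 0 = (t - 0) * (?f1 (p + a *\<^sub>R h + t *\<^sub>R k) - ?f1 (p + a *\<^sub>R h + 0 *\<^sub>R k))"
    by blast
  have "\<exists>b>0. b < t \<and> ?f1 (p + a *\<^sub>R h + t *\<^sub>R k) - ?f1 (p + a *\<^sub>R h + 0 *\<^sub>R k) =
        (t - 0) * frechet_derivative ?f1 (at (p + a *\<^sub>R h + b *\<^sub>R k)) k"
    using assms(2,3) a by (intro MVT2 D2) auto
  then obtain b where b: "0 < b" "b < t"
     "?f1 (p + a *\<^sub>R h + t *\<^sub>R k) - ?f1 (p + a *\<^sub>R h + 0 *\<^sub>R k) =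
        (t - 0) * frechet_derivative ?f1 (at (p + a *\<^sub>R h + b *\<^sub>R k)) k"
    by blast
  show ?thesis
    using that[of a b] a b by (simp add: algebra_simps)
qed

text \<open>The second difference over a small parallelogram does not see the order of
  \<open>h\<close> and \<open>k\<close>, while two mean value steps make it \<open>t * t\<close>
  times either mixed derivative at a nearby point. Continuity then forbids a gap at
  \<open>p\<close>.\<close>

lemma second_derivative_symmetric:
  fixes f :: "'a::real_normed_vector \<Rightarrow> real"
  assumes "open S" "Ck_on 2 S f" "p \<in> S"
  shows "frechet_derivative (\<lambda>q. frechet_derivative f (at q) h) (at p) k =
         frechet_derivative (\<lambda>q. frechet_derivative f (at q) k) (at p) h"
    (is "?A p = ?B p")
proof (rule ccontr)
  assume "?A p \<noteq> ?B p"
  define e where "e = \<bar>?A p - ?B p\<bar> / 2"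
  have e: "e > 0" using \<open>?A p \<noteq> ?B p\<close> by (simp add: e_def)
  have C: "continuous_on S ?A" "continuous_on S ?B"
    using assms(2) by (auto simp: numeral_2_eq_2)
  obtain d1 where d1: "d1 > 0" "\<And>q. q \<in> S \<Longrightarrow> dist q p < d1 \<Longrightarrow> dist (?A q) (?A p) < e"
    using C(1) e assms(3) unfolding continuous_on_iff by meson
  obtain d2 where d2: "d2 > 0" "\<And>q. q \<in> S \<Longrightarrow> dist q p < d2 \<Longrightarrow> dist (?B q) (?B p) < e"
    using C(2) e assms(3) unfolding continuous_on_iff by meson
  obtain d3 where d3: "d3 > 0" "ball p d3 \<subseteq> S"
    using assms(1,3) open_contains_ball by blast
  define d where "d = min d1 (min d2 d3)"
  \<comment> \<open>Small enough that the parallelogram with sides \<open>t\<close> times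
    \<open>h\<close> and \<open>k\<close> stays within \<open>d\<close> of \<open>p\<close>; the
    \<open>+ 1\<close> keeps the denominator positive.\<close>
  define t where "t = d / (norm h + norm k + 1)"
  have d: "d > 0" using d1 d2 d3 by (simp add: d_def)
  have n: "norm h + norm k + 1 > 0" by (smt (verit) norm_ge_zero)
  have t: "t > 0" using d n by (simp add: t_def)
  have near: "dist (p + a *\<^sub>R h + b *\<^sub>R k) p < d" if "0 \<le> a" "a \<le> t" "0 \<le> b" "b \<le> t" for a b
  proof -
    have "dist (p + a *\<^sub>R h + b *\<^sub>R k) p = norm (a *\<^sub>R h + b *\<^sub>R k)"
      by (simp add: dist_norm add.assoc)
    also have "\<dots> \<le> a * norm h + b * norm k"
      using norm_triangle_ineq[of "a *\<^sub>R h" "b *\<^sub>R k"] that by simp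
    also have "\<dots> \<le> t * norm h + t * norm k"
      using that by (intro add_mono mult_right_mono) auto
    also have "\<dots> < t * (norm h + norm k + 1)"
      using t by (simp add: algebra_simps)
    also have "\<dots> = d" using n by (simp add: t_def)
    finally show ?thesis .
  qed
  have inS: "p + a *\<^sub>R h + b *\<^sub>R k \<in> S" if "0 \<le> a" "a \<le> t" "0 \<le> b" "b \<le> t" for a b
    using near[OF that] d3(2) by (auto simp: d_def dist_commute)
  have inS': "p + a *\<^sub>R k + b *\<^sub>R h \<in> S" if "0 \<le> a" "a \<le> t" "0 \<le> b" "b \<le> t" for a b
    using inS[OF that(3,4,1,2)] by (simp add: algebra_simps)
  obtain a b where 1: "0 \<le> a" "a \<le> t" "0 \<le> b" "b \<le> t"
    "f (p + t *\<^sub>R h + t *\<^sub>R k) - f (p + t *\<^sub>R h) - f (p + t *\<^sub>R k) + f p = t * t * ?A (p + a *\<^sub>R h + b *\<^sub>R k)"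
    using second_difference_quotient[OF assms(2) t inS] by blast
  obtain a' b' where 2: "0 \<le> a'" "a' \<le> t" "0 \<le> b'" "b' \<le> t"
    "f (p + t *\<^sub>R k + t *\<^sub>R h) - f (p + t *\<^sub>R k) - f (p + t *\<^sub>R h) + f p = t * t * ?B (p + a' *\<^sub>R k + b' *\<^sub>R h)"
    using second_difference_quotient[OF assms(2) t inS'] by blast
  have "p + t *\<^sub>R k + t *\<^sub>R h = p + t *\<^sub>R h + t *\<^sub>R k" by (simp add: algebra_simps)
  from 1(5) 2(5)[unfolded this]
  have "t * t * ?A (p + a *\<^sub>R h + b *\<^sub>R k) = t * t * ?B (p + a' *\<^sub>R k + b' *\<^sub>R h)"
    by linarith
  with t have eq: "?A (p + a *\<^sub>R h + b *\<^sub>R k) = ?B (p + a' *\<^sub>R k + b' *\<^sub>R h)" by simp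
  have "dist (p + a' *\<^sub>R k + b' *\<^sub>R h) p < d"
    using near[OF 2(3,4,1,2)] by (simp add: ac_simps)
  then have "dist (?B (p + a' *\<^sub>R k + b' *\<^sub>R h)) (?B p) < e"
    using inS'[OF 2(1-4)] by (intro d2) (auto simp: d_def)
  moreover have "dist (?A (p + a *\<^sub>R h + b *\<^sub>R k)) (?A p) < e"
    using near[OF 1(1-4)] inS[OF 1(1-4)] by (intro d1) (auto simp: d_def)
  ultimately have "\<bar>?A p - ?B p\<bar> < 2 * e"
    using eq by (simp add: dist_real_def)
  then show False by (simp add: e_def)
qed

text \<open>Expanding the moving direction over the basis leaves products of scalar functions, to
  which the product and chain rules apply; the sums are then reassembled by linearity in the
  direction.\<close>

lemma has_derivative_directional_derivative:
  fixes f :: "'b::euclidean_space \<Rightarrow> real"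
  assumes T: "open T" "smooth_on T f" "Q p \<in> T"
    and Q: "(Q has_derivative Q') (at p)" and F: "(F has_derivative F') (at p)"
  shows "((\<lambda>p. frechet_derivative f (at (Q p)) (F p)) has_derivative
      (\<lambda>h. frechet_derivative (\<lambda>q. frechet_derivative f (at q) (F p)) (at (Q p)) (Q' h) +
        frechet_derivative f (at (Q p)) (F' h))) (at p)"
proof -
  let ?d = "\<lambda>q. frechet_derivative f (at q)"
  let ?H = "\<lambda>b k. frechet_derivative (\<lambda>q. ?d q b) (at (Q p)) k"
  have linH: "linear (?H b)" for b
    using smooth_on_frechet_derivative[OF T(2)] T(3) linear_frechet_derivative smooth_on_differentiable
    by blast
  have sym: "?H b k = ?H k b" for b k
    using T by (intro second_derivative_symmetric[of T]) (auto simp: smooth_on_def)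
  have ex: "((\<lambda>p. \<Sum>b\<in>Basis. (F p \<bullet> b) * ?d (Q p) b) has_derivative
      (\<lambda>h. \<Sum>b\<in>Basis. (F p \<bullet> b) * ?H b (Q' h) + (F' h \<bullet> b) * ?d (Q p) b)) (at p)"
  proof (intro has_derivative_sum)
    fix b :: 'b assume "b \<in> Basis"
    have "((\<lambda>q. ?d q b) has_derivative ?H b) (at (Q p))"
      by (rule smooth_on_has_derivative[OF smooth_on_frechet_derivative[OF T(2)] T(3)])
    then have "((\<lambda>p. ?d (Q p) b) has_derivative (\<lambda>h. ?H b (Q' h))) (at p)"
      by (rule has_derivative_compose[OF Q])
    from has_derivative_mult[OF has_derivative_inner_left[OF F, of b] this]
    show "((\<lambda>p. (F p \<bullet> b) * ?d (Q p) b) has_derivative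
         (\<lambda>h. (F p \<bullet> b) * ?H b (Q' h) + (F' h \<bullet> b) * ?d (Q p) b)) (at p)" .
  qed
  have eq: "(\<Sum>b\<in>Basis. (F p \<bullet> b) * ?H b k + (m \<bullet> b) * ?d (Q p) b) = ?H (F p) k + ?d (Q p) m" for k m
  proof -
    have "?d (Q p) m = (\<Sum>b\<in>Basis. (m \<bullet> b) * ?d (Q p) b)"
      using frechet_derivative_linear_sum[OF smooth_on_differentiable[OF T(2,3)], of m] by simp
    \<comment> \<open>The expansion of \<open>F p\<close> uses linearity in the slot of the second
      differentiation; symmetry then moves it to the other slot.\<close>
    moreover have "?H k (F p) = (\<Sum>b\<in>Basis. (F p \<bullet> b) * ?H k b)"
      using frechet_derivative_linear_sum[OF smooth_on_differentiable[OF
            smooth_on_frechet_derivative[OF T(2)] T(3)], of k "F p"] by simp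
    ultimately have "?H k (F p) + ?d (Q p) m =
        (\<Sum>b\<in>Basis. (F p \<bullet> b) * ?H k b) + (\<Sum>b\<in>Basis. (m \<bullet> b) * ?d (Q p) b)"
      by (rule arg_cong2[where f = plus, rotated])
    then show ?thesis by (simp only: sum.distrib sym[of _ k])
  qed
  have "\<forall>\<^sub>F p' in nhds p. Q p' \<in> T"
  proof -
    have "isCont Q p" using Q has_derivative_continuous by blast
    then have "(Q \<longlongrightarrow> Q p) (nhds p)" by (simp add: isCont_def tendsto_at_iff_tendsto_nhds)
    then show ?thesis using T by (metis topological_tendstoD)
  qed
  then obtain S where S: "open S" "p \<in> S" "\<And>p'. p' \<in> S \<Longrightarrow> Q p' \<in> T"
    unfolding eventually_nhds by blast
  show ?thesis
    using ex[unfolded eq]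
  proof (rule has_derivative_transform_within_open[OF _ S(1,2)])
    fix p' assume "p' \<in> S"
    then show "(\<Sum>b\<in>Basis. (F p' \<bullet> b) * ?d (Q p') b) = ?d (Q p') (F p')"
      using frechet_derivative_linear_sum[OF smooth_on_differentiable[OF T(2) S(3)], of p' "F p'"] by simp
  qed
qed

text \<open>Both sides contain the same Hessian term, which cancels by symmetry.\<close>

lemma lie_deriv_directional_derivative:
  fixes f :: "'b::euclidean_space \<Rightarrow> real"
  assumes T: "open T" "smooth_on T f" and P: "bounded_linear P" "P p \<in> T"
    and E: "E differentiable at p" and Y: "Y differentiable at (P p)" and rel: "P (X p) = Y (P p)"
  shows "lie_deriv X (\<lambda>p. frechet_derivative f (at (P p)) (E p)) p =
    frechet_derivative (lie_deriv Y f) (at (P p)) (E p) +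
    frechet_derivative f (at (P p)) (lie_deriv X E p - frechet_derivative Y (at (P p)) (E p))"
proof -
  let ?d = "\<lambda>q. frechet_derivative f (at q)"
  let ?H = "\<lambda>b k. frechet_derivative (\<lambda>q. ?d q b) (at (P p)) k"
  have lin: "linear (?d (P p))"
    using T P linear_frechet_derivative smooth_on_differentiable by blast
  have sym: "?H b k = ?H k b" for b k
    using T P by (intro second_derivative_symmetric[of T]) (auto simp: smooth_on_def)
  have "((\<lambda>p. ?d (P p) (E p)) has_derivative
      (\<lambda>h. ?H (E p) (P h) + ?d (P p) (frechet_derivative E (at p) h))) (at p)"
    by (rule has_derivative_directional_derivative[OF T P(2)
          bounded_linear_imp_has_derivative[OF P(1)] frechet_derivative_works[THEN iffD1, OF E]])
  from frechet_derivative_at[OF this]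
  have 1: "lie_deriv X (\<lambda>p. ?d (P p) (E p)) p = ?H (E p) (Y (P p)) + ?d (P p) (lie_deriv X E p)"
    unfolding lie_deriv_def rel[symmetric] by (rule fun_cong[symmetric])
  have "((\<lambda>q. ?d q (Y q)) has_derivative
      (\<lambda>h. ?H (Y (P p)) h + ?d (P p) (frechet_derivative Y (at (P p)) h))) (at (P p))"
    by (rule has_derivative_directional_derivative[OF T P(2)
          has_derivative_ident frechet_derivative_works[THEN iffD1, OF Y]])
  from frechet_derivative_at[OF this]
  have 2: "frechet_derivative (lie_deriv Y f) (at (P p)) (E p) =
      ?H (Y (P p)) (E p) + ?d (P p) (frechet_derivative Y (at (P p)) (E p))"
    unfolding lie_deriv_def[abs_def] by (rule fun_cong[symmetric])
  show ?thesis
    unfolding 1 2 linear_diff[OF lin] sym[of "E p"] by linarith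
qed

section \<open>Total derivatives and prolongations\<close>

text \<open>Near \<open>p\<close> both functions have the same derivatives, if any, so the choice
  behind \<open>frechet_derivative\<close> agrees even where neither is differentiable.\<close>

lemma frechet_derivative_cong_open:
  assumes "open S" "p \<in> S" "\<And>q. q \<in> S \<Longrightarrow> f q = g q"
  shows "frechet_derivative f (at p) = frechet_derivative g (at p)"
proof -
  have "(f has_derivative D) (at p) \<longleftrightarrow> (g has_derivative D) (at p)" for D
    using has_derivative_transform_within_open[OF _ assms(1,2), of f D UNIV g]
      has_derivative_transform_within_open[OF _ assms(1,2), of g D UNIV f] assms(3) by auto
  then show ?thesis by (simp add: frechet_derivative_def)
qed

lemma lie_deriv_cong_open:
  assumes "open S" "p \<in> S" "\<And>q. q \<in> S \<Longrightarrow> f q = g q"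
  shows "lie_deriv X f p = lie_deriv X g p"
  unfolding lie_deriv_def by (simp add: frechet_derivative_cong_open[OF assms])

lemma frechet_derivative_bounded_linear_compose:
  assumes "bounded_linear L" "f differentiable (at p)"
  shows "frechet_derivative (\<lambda>p. L (f p)) (at p) = (\<lambda>h. L (frechet_derivative f (at p) h))"
  by (rule frechet_derivative_at[OF bounded_linear.has_derivative[OF assms(1)
      frechet_derivative_works[THEN iffD1, OF assms(2)]], symmetric])

lemma frechet_derivative_compose_bounded_linear:
  assumes "bounded_linear P" "f differentiable (at (P p))"
  shows "frechet_derivative (\<lambda>p. f (P p)) (at p) = (\<lambda>h. frechet_derivative f (at (P p)) (P h))"
  by (rule frechet_derivative_at[OF has_derivative_compose[OF
      bounded_linear_imp_has_derivative[OF assms(1)] frechet_derivative_works[THEN iffD1, OF assms(2)]], symmetric])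

lemma frechet_derivative_bounded_linear:
  assumes "bounded_linear P"
  shows "frechet_derivative P (at p) = P"
  by (rule frechet_derivative_at[OF bounded_linear_imp_has_derivative[OF assms], symmetric])

lemma frechet_derivative_Pair:
  assumes "f differentiable (at p)" "g differentiable (at p)"
  shows "frechet_derivative (\<lambda>p. (f p, g p)) (at p) =
    (\<lambda>h. (frechet_derivative f (at p) h, frechet_derivative g (at p) h))"
  by (rule frechet_derivative_at[OF has_derivative_Pair[OF
      frechet_derivative_works[THEN iffD1, OF assms(1)]
      frechet_derivative_works[THEN iffD1, OF assms(2)]], symmetric])

lemma frechet_derivative_diff:
  assumes "f differentiable (at p)" "g differentiable (at p)"
  shows "frechet_derivative (\<lambda>p. f p - g p) (at p) =
    (\<lambda>h. frechet_derivative f (at p) h - frechet_derivative g (at p) h)"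
  by (rule frechet_derivative_at[OF has_derivative_diff[OF
      frechet_derivative_works[THEN iffD1, OF assms(1)]
      frechet_derivative_works[THEN iffD1, OF assms(2)]], symmetric])

lemma frechet_derivative_mult:
  fixes f g :: "'a::real_normed_vector \<Rightarrow> real"
  assumes "f differentiable (at p)" "g differentiable (at p)"
  shows "frechet_derivative (\<lambda>p. f p * g p) (at p) =
    (\<lambda>h. f p * frechet_derivative g (at p) h + frechet_derivative f (at p) h * g p)"
  by (rule frechet_derivative_at[OF has_derivative_mult[OF
      frechet_derivative_works[THEN iffD1, OF assms(1)]
      frechet_derivative_works[THEN iffD1, OF assms(2)]], symmetric])

lemma frechet_derivative_divide:
  fixes f g :: "'a::real_normed_vector \<Rightarrow> real"
  assumes "f differentiable (at p)" "g differentiable (at p)" "g p \<noteq> 0"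
  shows "frechet_derivative (\<lambda>p. f p / g p) (at p) =
    (\<lambda>h. (frechet_derivative f (at p) h * g p - f p * frechet_derivative g (at p) h) / (g p * g p))"
  by (rule frechet_derivative_at[OF has_derivative_divide'[OF
      frechet_derivative_works[THEN iffD1, OF assms(1)]
      frechet_derivative_works[THEN iffD1, OF assms(2)] assms(3)], symmetric])

lemma frechet_derivative_chain:
  assumes "f differentiable (at p)" "g differentiable (at (f p))"
  shows "frechet_derivative (\<lambda>p. g (f p)) (at p) =
    (\<lambda>h. frechet_derivative g (at (f p)) (frechet_derivative f (at p) h))"
  by (rule frechet_derivative_at[OF has_derivative_compose[OF
      frechet_derivative_works[THEN iffD1, OF assms(1)]
      frechet_derivative_works[THEN iffD1, OF assms(2)]], symmetric])

lemma smooth_on_lie_deriv: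
  fixes f :: "'a::euclidean_space \<Rightarrow> real"
  assumes "open S" "smooth_on S f" "smooth_on S X"
  shows "smooth_on S (lie_deriv X f)"
  using smooth_on_directional_derivative[OF assms(1,2) smooth_on_ident _ assms(3)]
  unfolding lie_deriv_def[abs_def] by auto

text \<open>Forgets the top coordinate of a first-order jet; it serves both for
  \<open>(x, u, u1)\<close> and for the reduced variables \<open>(y, w, w1)\<close>.\<close>

definition base :: "R3 \<Rightarrow> R2" where "base q = (fst q, fst (snd q))"

lemma bounded_linear_base: "bounded_linear base"
  unfolding base_def[abs_def]
  by (intro bounded_linear_Pair bounded_linear_fst bounded_linear_snd
      bounded_linear_compose[OF bounded_linear_fst bounded_linear_snd])

lemma jet1_eq: "jet1 = (\<lambda>p. (fst p, fst (snd p), fst (snd (snd p))))"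
  by (auto simp: fun_eq_iff)

lemma bounded_linear_jet1: "bounded_linear jet1"
  unfolding jet1_eq
  by (intro bounded_linear_Pair bounded_linear_fst bounded_linear_snd
      bounded_linear_compose[OF bounded_linear_fst bounded_linear_snd]
      bounded_linear_compose[OF bounded_linear_fst bounded_linear_compose[OF bounded_linear_snd bounded_linear_snd]])

lemma base_jet1: "base (jet1 p) = jet0 p"
  by (cases p rule: jet1.cases) (simp add: base_def)

lemma open_vimage_base: "open U \<Longrightarrow> open (base -` U)"
  using bounded_linear.continuous_on[OF bounded_linear_base continuous_on_id]
  by (simp add: open_vimage)

lemma open_vimage_jet1: "open Q \<Longrightarrow> open (jet1 -` Q)"
  using bounded_linear.continuous_on[OF bounded_linear_jet1 continuous_on_id]
  by (simp add: open_vimage)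

lemma D1_eq: "D1 f = (\<lambda>q. frechet_derivative f (at (base q)) (1, snd (snd q)))"
  by (auto simp: fun_eq_iff base_def)

lemma D2_eq: "D2 f = (\<lambda>p. frechet_derivative f (at (jet1 p)) (1, snd (snd p)))"
  by (auto simp: fun_eq_iff)

lemma ode3_field_eq: "ode3_field \<phi> = (\<lambda>p. (1, fst (snd (snd p)), snd (snd (snd p)), \<phi> p))"
  by (auto simp: fun_eq_iff)

lemma eta1_eq: "eta1 v = (\<lambda>q. D1 (\<lambda>p. snd (v p)) q - snd (snd q) * D1 (\<lambda>p. fst (v p)) q)"
  by (auto simp: fun_eq_iff comp_def)

lemma eta2_eq: "eta2 v = (\<lambda>p. D2 (eta1 v) p - snd (snd (snd p)) * D1 (\<lambda>p. fst (v p)) (jet1 p))"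
  by (auto simp: fun_eq_iff comp_def)

lemma prol1_eq: "prol1 v = (\<lambda>q. (fst (v (base q)), snd (v (base q)), eta1 v q))"
  by (auto simp: fun_eq_iff base_def)

lemma prol2_eq:
  "prol2 v = (\<lambda>p. (fst (v (base (jet1 p))), snd (v (base (jet1 p))), eta1 v (jet1 p), eta2 v p))"
  by (auto simp: fun_eq_iff base_def)

lemma base_prol1: "base (prol1 v q) = v (base q)"
  by (simp add: prol1_eq base_def)

lemma jet1_prol2: "jet1 (prol2 v p) = prol1 v (jet1 p)"
  by (simp add: prol1_eq prol2_eq)

section \<open>Smoothness of total derivatives and prolonged fields\<close>

lemma smooth_on_base: "smooth_on Q base"
  using smooth_on_bounded_linear_compose[OF open_UNIV bounded_linear_base smooth_on_ident]
  by (rule smooth_on_subset) simp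

lemma smooth_on_jet1: "smooth_on M jet1"
  using smooth_on_bounded_linear_compose[OF open_UNIV bounded_linear_jet1 smooth_on_ident]
  by (rule smooth_on_subset) simp

lemma smooth_on_snd_snd: "open S \<Longrightarrow> smooth_on S (\<lambda>p. snd (snd p))"
  by (intro smooth_on_snd smooth_on_ident)

lemma smooth_on_compose_base:
  assumes "open U" "smooth_on U f"
  shows "smooth_on (base -` U) (\<lambda>q. f (base q))"
  by (rule smooth_on_compose[OF open_vimage_base[OF assms(1)] assms(2) smooth_on_base]) auto

lemma smooth_on_compose_jet1:
  assumes "open Q" "smooth_on Q f"
  shows "smooth_on (jet1 -` Q) (\<lambda>p. f (jet1 p))"
  by (rule smooth_on_compose[OF open_vimage_jet1[OF assms(1)] assms(2) smooth_on_jet1]) auto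

lemma smooth_on_D1:
  assumes "open U" "smooth_on U f"
  shows "smooth_on (base -` U) (D1 f)"
  unfolding D1_eq
  by (rule smooth_on_directional_derivative[OF open_vimage_base[OF assms(1)] assms(2) smooth_on_base])
    (auto intro!: smooth_on_Pair smooth_on_const smooth_on_snd_snd open_vimage_base assms)

lemma smooth_on_D2:
  assumes "open Q" "smooth_on Q f"
  shows "smooth_on (jet1 -` Q) (D2 f)"
  unfolding D2_eq
  by (rule smooth_on_directional_derivative[OF open_vimage_jet1[OF assms(1)] assms(2) smooth_on_jet1])
    (auto intro!: smooth_on_Pair smooth_on_const smooth_on_snd_snd open_vimage_jet1 assms)

lemma smooth_on_eta1:
  assumes "open U" "smooth_on U v"
  shows "smooth_on (base -` U) (eta1 v)"
  unfolding eta1_eq using assms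
  by (intro smooth_on_diff smooth_on_mult smooth_on_D1 smooth_on_fst smooth_on_snd
      open_vimage_base smooth_on_ident)

lemma smooth_on_eta2:
  assumes "open U" "smooth_on U v"
  shows "smooth_on (jet1 -` base -` U) (eta2 v)"
  unfolding eta2_eq using assms
  by (intro smooth_on_diff smooth_on_mult smooth_on_compose_jet1 smooth_on_D1 smooth_on_D2
      smooth_on_eta1 smooth_on_fst smooth_on_snd open_vimage_base open_vimage_jet1 smooth_on_ident)

lemma smooth_on_prol1:
  assumes "open U" "smooth_on U v"
  shows "smooth_on (base -` U) (prol1 v)"
  unfolding prol1_eq using assms
  by (intro smooth_on_Pair smooth_on_compose_base smooth_on_eta1 smooth_on_fst smooth_on_snd
      open_vimage_base)

lemma smooth_on_prol2:
  assumes "open U" "smooth_on U v"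
  shows "smooth_on (jet1 -` base -` U) (prol2 v)"
  unfolding prol2_eq using assms
  by (intro smooth_on_Pair smooth_on_compose_jet1 smooth_on_compose_base smooth_on_eta1 smooth_on_eta2
      smooth_on_fst smooth_on_snd open_vimage_base open_vimage_jet1)

lemma lie_deriv_compose_jet1:
  assumes "f differentiable (at (jet1 p))" "jet1 (X p) = Y (jet1 p)"
  shows "lie_deriv X (\<lambda>p. f (jet1 p)) p = lie_deriv Y f (jet1 p)"
  unfolding lie_deriv_def
  by (simp add: frechet_derivative_compose_bounded_linear[OF bounded_linear_jet1 assms(1)] assms(2))

lemma D2_compose_base:
  assumes "f differentiable (at (base (jet1 p)))"
  shows "D2 (\<lambda>q. f (base q)) p = D1 f (jet1 p)"
  unfolding D2_eq D1_eq
  by (simp add: frechet_derivative_compose_bounded_linear[OF bounded_linear_base assms])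
    (simp add: base_def jet1_eq)

text \<open>The field of the equation differs from the total derivative only in the last component,
  which a function of the first-order jet does not see.\<close>

lemma lie_deriv_ode3_field_compose_jet1:
  assumes "f differentiable (at (jet1 p))"
  shows "lie_deriv (ode3_field \<phi>) (\<lambda>p. f (jet1 p)) p = D2 f p"
  unfolding D2_eq lie_deriv_def
  by (simp add: frechet_derivative_compose_bounded_linear[OF bounded_linear_jet1 assms])
    (simp add: ode3_field_eq jet1_eq)

lemma D1_fst_snd:
  assumes "v differentiable (at (base q))"
  shows "frechet_derivative v (at (base q)) (1, snd (snd q)) = (D1 (\<lambda>p. fst (v p)) q, D1 (\<lambda>p. snd (v p)) q)"
  by (simp add: D1_eq frechet_derivative_bounded_linear_compose[OF bounded_linear_fst assms]
      frechet_derivative_bounded_linear_compose[OF bounded_linear_snd assms])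

lemma lie_deriv_snd_snd: "lie_deriv X (\<lambda>q. snd (snd q)) p = snd (snd (X p))"
  unfolding lie_deriv_def
  by (simp add: frechet_derivative_bounded_linear bounded_linear_compose[OF bounded_linear_snd bounded_linear_snd])

lemma lie_deriv_Pair_const:
  assumes "f differentiable (at p)"
  shows "lie_deriv X (\<lambda>p. (c, f p)) p = (0, lie_deriv X f p)"
  unfolding lie_deriv_def by (simp add: frechet_derivative_Pair assms)

lemma differentiable_snd_snd: "(\<lambda>q. snd (snd q)) differentiable (at p)"
  by (rule bounded_linear_imp_differentiable[OF bounded_linear_compose[OF bounded_linear_snd bounded_linear_snd]])

lemma differentiable_Pair:
  assumes "f differentiable (at p)" "g differentiable (at p)"
  shows "(\<lambda>p. (f p, g p)) differentiable (at p)"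
  by (rule differentiableI[OF has_derivative_Pair[OF frechet_derivative_works[THEN iffD1, OF assms(1)]
          frechet_derivative_works[THEN iffD1, OF assms(2)]]])

lemma differentiable_fst_snd:
  assumes "v differentiable (at p)"
  shows "(\<lambda>p. fst (v p)) differentiable (at p)" "(\<lambda>p. snd (v p)) differentiable (at p)"
  using assms unfolding differentiable_def by (blast intro: has_derivative_fst has_derivative_snd)+

lemma differentiable_compose_base:
  "f differentiable (at (base q)) \<Longrightarrow> (\<lambda>q. f (base q)) differentiable (at q)"
  unfolding differentiable_def
  by (blast intro: has_derivative_compose[OF bounded_linear_imp_has_derivative[OF bounded_linear_base]])

lemma differentiable_compose_jet1:
  "f differentiable (at (jet1 q)) \<Longrightarrow> (\<lambda>q. f (jet1 q)) differentiable (at q)"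
  unfolding differentiable_def
  by (blast intro: has_derivative_compose[OF bounded_linear_imp_has_derivative[OF bounded_linear_jet1]])

text \<open>The commutator of a prolonged field with the total derivative is a multiple of the latter.\<close>

lemma prol1_D1:
  assumes "open U" "smooth_on U f" "smooth_on U v" "base q \<in> U"
  shows "lie_deriv (prol1 v) (D1 f) q = D1 (lie_deriv v f) q - D1 (\<lambda>p. fst (v p)) q * D1 f q"
proof -
  let ?E = "\<lambda>q::R3. (1::real, snd (snd q))"
  have dv: "v differentiable (at (base q))" and df: "f differentiable (at (base q))"
    using assms smooth_on_differentiable by blast+
  \<comment> \<open>\<open>?E\<close> is the direction of the total derivative. The component
    \<open>eta1\<close> is exactly what makes this difference proportional to
    \<open>?E\<close>.\<close>
  have E: "lie_deriv (prol1 v) ?E q - frechet_derivative v (at (base q)) (?E q) =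
      (- D1 (\<lambda>p. fst (v p)) q) *\<^sub>R ?E q"
    by (simp add: lie_deriv_Pair_const[OF differentiable_snd_snd] lie_deriv_snd_snd D1_fst_snd[OF dv] prol1_eq eta1_eq)
  have "lie_deriv (prol1 v) (D1 f) q = frechet_derivative (lie_deriv v f) (at (base q)) (?E q) +
      frechet_derivative f (at (base q)) ((- D1 (\<lambda>p. fst (v p)) q) *\<^sub>R ?E q)"
    unfolding E[symmetric] D1_eq[of f]
    by (rule lie_deriv_directional_derivative[where P = base and p = q and E = ?E and X = "prol1 v",
          OF assms(1,2) bounded_linear_base assms(4)
          differentiable_Pair[OF differentiable_const differentiable_snd_snd] dv base_prol1])
  also have "\<dots> = D1 (lie_deriv v f) q - D1 (\<lambda>p. fst (v p)) q * D1 f q"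
    unfolding linear_cmul[OF linear_frechet_derivative[OF df]]
    by (simp add: D1_eq[of f] D1_eq[of "lie_deriv v f"])
  finally show ?thesis .
qed

text \<open>The first two components are pulled back from \<open>(x, u)\<close>, where
  \<open>D2\<close> collapses to \<open>D1\<close>. These are the terms that \<open>prol2\<close> is
  compared with in its commutator with \<open>D2\<close>.\<close>

lemma frechet_derivative_prol1:
  assumes "open U" "smooth_on U v" "base (jet1 p) \<in> U"
  shows "frechet_derivative (prol1 v) (at (jet1 p)) (1, snd (snd p)) =
    (D1 (\<lambda>p. fst (v p)) (jet1 p), D1 (\<lambda>p. snd (v p)) (jet1 p), D2 (eta1 v) p)"
proof -
  have dv: "v differentiable (at (base (jet1 p)))"
    using assms smooth_on_differentiable by blast
  have de: "eta1 v differentiable (at (jet1 p))"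
    using smooth_on_eta1[OF assms(1,2)] smooth_on_differentiable assms(3) by blast
  note d = differentiable_fst_snd[OF dv]
  note d' = differentiable_compose_base[OF d(1)] differentiable_compose_base[OF d(2)]
  have "(\<lambda>q. (snd (v (base q)), eta1 v q)) differentiable (at (jet1 p))"
    by (rule differentiable_Pair[OF d'(2) de])
  then have "frechet_derivative (prol1 v) (at (jet1 p)) (1, snd (snd p)) =
    (D2 (\<lambda>q. fst (v (base q))) p, D2 (\<lambda>q. snd (v (base q))) p, D2 (eta1 v) p)"
    unfolding prol1_eq[of v] D2_eq
    by (simp add: frechet_derivative_Pair d' de)
  then show ?thesis
    by (simp only: D2_compose_base[of "\<lambda>p. fst (v p)", OF d(1)] D2_compose_base[of "\<lambda>p. snd (v p)", OF d(2)])
qed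

text \<open>One order above the rule for \<open>D1\<close>, with \<open>jet1\<close> for
  \<open>base\<close> and \<open>prol1 v\<close> as the projected field; the formula for
  \<open>eta2\<close> again makes the commutator proportional to the total derivative.\<close>

lemma prol2_D2:
  assumes "open U" "smooth_on U v" "open Q" "smooth_on Q f" "jet1 p \<in> Q" "base (jet1 p) \<in> U"
  shows "lie_deriv (prol2 v) (D2 f) p =
    D2 (lie_deriv (prol1 v) f) p - D1 (\<lambda>p. fst (v p)) (jet1 p) * D2 f p"
proof -
  let ?E = "\<lambda>p::R4. (1::real, snd (snd p))"
  have df: "f differentiable (at (jet1 p))"
    using assms smooth_on_differentiable by blast
  have dX: "prol1 v differentiable (at (jet1 p))"
    using smooth_on_prol1[OF assms(1,2)] smooth_on_differentiable assms(6) by blast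
  have E: "lie_deriv (prol2 v) ?E p - frechet_derivative (prol1 v) (at (jet1 p)) (?E p) =
      (- D1 (\<lambda>p. fst (v p)) (jet1 p)) *\<^sub>R ?E p"
    unfolding frechet_derivative_prol1[OF assms(1,2,6)]
    by (simp add: lie_deriv_Pair_const[OF differentiable_snd_snd] lie_deriv_snd_snd prol2_eq)
     (simp add: jet1_eq eta1_eq eta2_eq prod_eq_iff)
  have "lie_deriv (prol2 v) (D2 f) p = frechet_derivative (lie_deriv (prol1 v) f) (at (jet1 p)) (?E p) +
      frechet_derivative f (at (jet1 p)) ((- D1 (\<lambda>p. fst (v p)) (jet1 p)) *\<^sub>R ?E p)"
    unfolding E[symmetric] D2_eq[of f]
    by (rule lie_deriv_directional_derivative[where P = jet1 and p = p and E = ?E and X = "prol2 v",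
          OF assms(3,4) bounded_linear_jet1 assms(5)
          differentiable_Pair[OF differentiable_const differentiable_snd_snd] dX jet1_prol2])
  also have "\<dots> = D2 (lie_deriv (prol1 v) f) p - D1 (\<lambda>p. fst (v p)) (jet1 p) * D2 f p"
    unfolding linear_cmul[OF linear_frechet_derivative[OF df]]
    by (simp add: D2_eq)
  finally show ?thesis .
qed

section \<open>Prolongation and Lie brackets\<close>

lemma lie_deriv_diff:
  "f differentiable (at p) \<Longrightarrow> g differentiable (at p) \<Longrightarrow>
    lie_deriv X (\<lambda>p. f p - g p) p = lie_deriv X f p - lie_deriv X g p"
  by (simp add: lie_deriv_def frechet_derivative_diff)

lemma lie_deriv_mult:
  fixes f g :: "'a::real_normed_vector \<Rightarrow> real"
  shows "f differentiable (at p) \<Longrightarrow> g differentiable (at p) \<Longrightarrow>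
    lie_deriv X (\<lambda>p. f p * g p) p = f p * lie_deriv X g p + lie_deriv X f p * g p"
  by (simp add: lie_deriv_def frechet_derivative_mult)

lemma lie_deriv_divide:
  fixes f g :: "'a::real_normed_vector \<Rightarrow> real"
  shows "f differentiable (at p) \<Longrightarrow> g differentiable (at p) \<Longrightarrow> g p \<noteq> 0 \<Longrightarrow>
    lie_deriv X (\<lambda>p. f p / g p) p = (lie_deriv X f p * g p - f p * lie_deriv X g p) / (g p * g p)"
  by (simp add: lie_deriv_def frechet_derivative_divide)

lemma differentiable_mult_real:
  fixes f g :: "'a::real_normed_vector \<Rightarrow> real"
  shows "f differentiable (at p) \<Longrightarrow> g differentiable (at p) \<Longrightarrow> (\<lambda>p. f p * g p) differentiable (at p)"
  unfolding differentiable_def by (blast intro: has_derivative_mult)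

text \<open>\<open>L\<close> stands for either coordinate projection, so one statement covers the
  \<xi>- and the \<eta>-component.\<close>

lemma D1_lie_bracket:
  assumes "open U" "smooth_on U v" "smooth_on U w" "base q \<in> U" "bounded_linear L"
  shows "D1 (\<lambda>p. (L :: R2 \<Rightarrow> real) (lie_bracket v w p)) q =
    D1 (lie_deriv v (\<lambda>p. L (w p))) q - D1 (lie_deriv w (\<lambda>p. L (v p))) q"
proof -
  have d: "lie_deriv a (\<lambda>p. L (b p)) differentiable (at (base q))"
    if "smooth_on U a" "smooth_on U b" for a b
    using smooth_on_lie_deriv[OF assms(1) smooth_on_bounded_linear_compose[OF assms(1,5) that(2)] that(1)]
      assms(4) by (rule smooth_on_differentiable)
  have "D1 (\<lambda>p. L (lie_bracket v w p)) q =
      D1 (\<lambda>p. lie_deriv v (\<lambda>p. L (w p)) p - lie_deriv w (\<lambda>p. L (v p)) p) q"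
    unfolding D1_eq
  proof (subst frechet_derivative_cong_open[OF assms(1,4)])
    fix p assume "p \<in> U"
    then show "L (lie_bracket v w p) = lie_deriv v (\<lambda>p. L (w p)) p - lie_deriv w (\<lambda>p. L (v p)) p"
      using smooth_on_differentiable[OF assms(2)] smooth_on_differentiable[OF assms(3)]
      by (simp add: lie_bracket_def lie_deriv_def linear_diff[OF bounded_linear.linear[OF assms(5)]]
          frechet_derivative_bounded_linear_compose[OF assms(5)])
  qed simp
  then show ?thesis
    by (simp add: D1_eq frechet_derivative_diff d assms)
qed

text \<open>After the commutator rule for \<open>D1\<close>, the terms quadratic in total
  derivatives of the components are symmetric in \<open>v\<close> and \<open>w\<close> once
  \<open>eta1\<close> is written out, so they cancel in the difference.\<close>

lemma eta1_lie_bracket: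
  assumes "open U" "smooth_on U v" "smooth_on U w" "base q \<in> U"
  shows "eta1 (lie_bracket v w) q = lie_deriv (prol1 v) (eta1 w) q - lie_deriv (prol1 w) (eta1 v) q"
proof -
  have eq: "lie_deriv (prol1 v) (eta1 w) q =
     D1 (lie_deriv v (\<lambda>p. snd (w p))) q - D1 (\<lambda>p. fst (v p)) q * D1 (\<lambda>p. snd (w p)) q
     - eta1 v q * D1 (\<lambda>p. fst (w p)) q
     - snd (snd q) * (D1 (lie_deriv v (\<lambda>p. fst (w p))) q - D1 (\<lambda>p. fst (v p)) q * D1 (\<lambda>p. fst (w p)) q)"
    if v: "smooth_on U v" and w: "smooth_on U w" for v w
  proof -
    have s: "smooth_on U (\<lambda>p. fst (w p))" "smooth_on U (\<lambda>p. snd (w p))"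
      using assms(1) w by (auto intro: smooth_on_fst smooth_on_snd)
    have d: "D1 (\<lambda>p. fst (w p)) differentiable (at q)" "D1 (\<lambda>p. snd (w p)) differentiable (at q)"
      using smooth_on_D1[OF assms(1) s(1)] smooth_on_D1[OF assms(1) s(2)] smooth_on_differentiable assms(4)
      by blast+
    show ?thesis
      unfolding eta1_eq[of w]
      by (simp add: lie_deriv_diff lie_deriv_mult differentiable_mult_real d differentiable_snd_snd
          lie_deriv_snd_snd prol1_D1[OF assms(1) s(1) v assms(4)] prol1_D1[OF assms(1) s(2) v assms(4)])
        (simp add: prol1_eq)
  qed
  show ?thesis
    unfolding eq[OF assms(2,3)] eq[OF assms(3,2)] eta1_eq[of "lie_bracket v w"]
      D1_lie_bracket[OF assms bounded_linear_fst] D1_lie_bracket[OF assms bounded_linear_snd]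
    by (simp add: eta1_eq algebra_simps)
qed

text \<open>\<open>D2\<close> is applied to the bracket formula for \<open>eta1\<close>; the
  remaining products are again symmetric in \<open>v\<close> and \<open>w\<close>.\<close>

lemma eta2_lie_bracket:
  assumes "open U" "smooth_on U v" "smooth_on U w" "base (jet1 p) \<in> U"
  shows "eta2 (lie_bracket v w) p = lie_deriv (prol2 v) (eta2 w) p - lie_deriv (prol2 w) (eta2 v) p"
proof -
  let ?Q = "base -` U"
  have Q: "open ?Q" "jet1 p \<in> ?Q" using assms open_vimage_base by auto
  have eq: "lie_deriv (prol2 v) (eta2 w) p =
     D2 (lie_deriv (prol1 v) (eta1 w)) p - D1 (\<lambda>p. fst (v p)) (jet1 p) * D2 (eta1 w) p
     - eta2 v p * D1 (\<lambda>p. fst (w p)) (jet1 p)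
     - snd (snd (snd p)) * (D1 (lie_deriv v (\<lambda>p. fst (w p))) (jet1 p)
          - D1 (\<lambda>p. fst (v p)) (jet1 p) * D1 (\<lambda>p. fst (w p)) (jet1 p))"
    if v: "smooth_on U v" and w: "smooth_on U w" for v w
  proof -
    have s: "smooth_on U (\<lambda>p. fst (w p))" "smooth_on ?Q (eta1 w)"
      using assms(1) w by (auto intro: smooth_on_fst smooth_on_eta1)
    have d: "D1 (\<lambda>p. fst (w p)) differentiable (at (jet1 p))" "D2 (eta1 w) differentiable (at p)"
      using smooth_on_D1[OF assms(1) s(1)] smooth_on_D2[OF Q(1) s(2)] smooth_on_differentiable assms(4)
      by blast+
    have "bounded_linear (\<lambda>p::R4. snd (snd (snd p)))"
      by (intro bounded_linear_compose[OF bounded_linear_snd] bounded_linear_snd)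
    then have u2: "(\<lambda>p::R4. snd (snd (snd p))) differentiable (at p)"
      "lie_deriv (prol2 v) (\<lambda>p. snd (snd (snd p))) p = snd (snd (snd (prol2 v p)))"
      by (auto simp: lie_deriv_def frechet_derivative_bounded_linear bounded_linear_imp_differentiable)
    show ?thesis
      unfolding eta2_eq[of w]
      by (simp add: lie_deriv_diff lie_deriv_mult differentiable_mult_real d u2
          differentiable_compose_jet1 lie_deriv_compose_jet1[where Y = "prol1 v"] jet1_prol2
          prol1_D1[OF assms(1) s(1) v assms(4)] prol2_D2[OF assms(1) v Q(1) s(2) Q(2) assms(4)])
        (simp add: prol2_eq)
  qed
  have d: "lie_deriv (prol1 v) (eta1 w) differentiable (at (jet1 p))"
    if v: "smooth_on U v" and w: "smooth_on U w" for v w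
    using smooth_on_lie_deriv[OF Q(1) smooth_on_eta1[OF assms(1) w] smooth_on_prol1[OF assms(1) v]]
     Q(2) by (rule smooth_on_differentiable)
  have "D2 (eta1 (lie_bracket v w)) p =
      D2 (\<lambda>q. lie_deriv (prol1 v) (eta1 w) q - lie_deriv (prol1 w) (eta1 v) q) p"
    unfolding D2_eq
    by (subst frechet_derivative_cong_open[OF Q]) (auto intro: eta1_lie_bracket assms)
  also have "\<dots> = D2 (lie_deriv (prol1 v) (eta1 w)) p - D2 (lie_deriv (prol1 w) (eta1 v)) p"
    unfolding D2_eq by (simp add: frechet_derivative_diff d assms)
  finally show ?thesis
    unfolding eq[OF assms(2,3)] eq[OF assms(3,2)] eta2_eq[of "lie_bracket v w"]
      D1_lie_bracket[OF assms bounded_linear_fst]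
    by (simp add: eta2_eq algebra_simps)
qed

lemma frechet_derivative_prol2:
  assumes "open U" "smooth_on U w" "base (jet1 p) \<in> U"
  shows "frechet_derivative (prol2 w) (at p) h =
    (frechet_derivative (\<lambda>p. fst (w p)) (at (base (jet1 p))) (base (jet1 h)),
     frechet_derivative (\<lambda>p. snd (w p)) (at (base (jet1 p))) (base (jet1 h)),
     frechet_derivative (eta1 w) (at (jet1 p)) (jet1 h), frechet_derivative (eta2 w) (at p) h)"
proof -
  have dw: "w differentiable (at (base (jet1 p)))"
    using assms smooth_on_differentiable by blast
  have d1: "eta1 w differentiable (at (jet1 p))" and d2: "eta2 w differentiable (at p)"
    using smooth_on_eta1[OF assms(1,2)] smooth_on_eta2[OF assms(1,2)] smooth_on_differentiable assms(3) by blast+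
  note d = differentiable_fst_snd[OF dw]
  note d' = differentiable_compose_base[OF d(1)] differentiable_compose_base[OF d(2)]
  have "((prol2 w) has_derivative (\<lambda>h. (frechet_derivative (\<lambda>p. fst (w p)) (at (base (jet1 p))) (base (jet1 h)),
     frechet_derivative (\<lambda>p. snd (w p)) (at (base (jet1 p))) (base (jet1 h)),
     frechet_derivative (eta1 w) (at (jet1 p)) (jet1 h), frechet_derivative (eta2 w) (at p) h))) (at p)"
    unfolding prol2_eq
    by (intro has_derivative_Pair frechet_derivative_works[THEN iffD1, OF d2]
      has_derivative_compose[OF bounded_linear_imp_has_derivative[OF bounded_linear_jet1] frechet_derivative_works[THEN iffD1, OF d1]]
      has_derivative_compose[OF bounded_linear_imp_has_derivative[OF bounded_linear_compose[OF bounded_linear_base bounded_linear_jet1]]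
         frechet_derivative_works[THEN iffD1, OF d(1)]]
      has_derivative_compose[OF bounded_linear_imp_has_derivative[OF bounded_linear_compose[OF bounded_linear_base bounded_linear_jet1]]
         frechet_derivative_works[THEN iffD1, OF d(2)]])
  from frechet_derivative_at[OF this] show ?thesis by (rule fun_cong[symmetric])
qed

lemma prol2_lie_bracket:
  assumes "open U" "smooth_on U v" "smooth_on U w" "base (jet1 p) \<in> U"
  shows "lie_bracket (prol2 v) (prol2 w) p = prol2 (lie_bracket v w) p"
proof -
  have dw: "v differentiable (at (base (jet1 p)))" "w differentiable (at (base (jet1 p)))"
    using assms smooth_on_differentiable by blast+
  show ?thesis
    unfolding lie_bracket_def[of "prol2 v"] lie_deriv_def frechet_derivative_prol2[OF assms(1,2,4)]
      frechet_derivative_prol2[OF assms(1,3,4)] jet1_prol2 base_prol1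
    using eta1_lie_bracket[OF assms] eta2_lie_bracket[OF assms]
    by (simp add: prol2_eq lie_bracket_def lie_deriv_def dw
      frechet_derivative_bounded_linear_compose[OF bounded_linear_fst]
      frechet_derivative_bounded_linear_compose[OF bounded_linear_snd])
qed

text \<open>The case of the identity for \<open>P\<close> in
  \<open>lie_deriv_directional_derivative\<close>; the rules for total derivatives are its cases
  \<open>base\<close> and \<open>jet1\<close>.\<close>

lemma lie_deriv_commute:
  fixes f :: "'a::euclidean_space \<Rightarrow> real"
  assumes "open S" "smooth_on S f" "X differentiable (at p)" "Y differentiable (at p)" "p \<in> S"
  shows "lie_deriv X (lie_deriv Y f) p = lie_deriv Y (lie_deriv X f) p +
    frechet_derivative f (at p) (lie_bracket X Y p)"
  using lie_deriv_directional_derivative[OF assms(1,2) bounded_linear_ident assms(5,4,3), of X]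
  by (simp add: lie_deriv_def[of Y "lie_deriv X f"] lie_bracket_def lie_deriv_def[of Y X])
   (simp add: lie_deriv_def[abs_def])

text \<open>Carries the factor 2 in [v1, v2] = 2 v3 over to the prolonged fields.\<close>

lemma prol2_scaleR:
  assumes "open U" "smooth_on U v" "base (jet1 p) \<in> U"
  shows "prol2 (\<lambda>p. c *\<^sub>R v p) p = c *\<^sub>R prol2 v p"
proof -
  have D1: "D1 (\<lambda>p. c * L (v p)) q = c * D1 (\<lambda>p. L (v p)) q"
    if "base q \<in> U" "bounded_linear L" for q and L :: "R2 \<Rightarrow> real"
    using frechet_derivative_bounded_linear_compose[OF bounded_linear_mult_right[of c]
        smooth_on_differentiable[OF smooth_on_bounded_linear_compose[OF assms(1) that(2) assms(2)] that(1)]]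
    by (simp add: D1_eq)
  have e1: "eta1 (\<lambda>p. c *\<^sub>R v p) q = c * eta1 v q" if "base q \<in> U" for q
    using D1[OF that bounded_linear_fst] D1[OF that bounded_linear_snd]
    by (simp add: eta1_eq algebra_simps)
  have "D2 (eta1 (\<lambda>p. c *\<^sub>R v p)) p = D2 (\<lambda>q. c * eta1 v q) p"
    unfolding D2_eq
    by (subst frechet_derivative_cong_open[OF open_vimage_base[OF assms(1)], of "jet1 p"]) (auto intro: e1 assms)
  also have "\<dots> = c * D2 (eta1 v) p"
    unfolding D2_eq using smooth_on_differentiable[OF smooth_on_eta1[OF assms(1,2)]] assms(3)
    by (subst frechet_derivative_bounded_linear_compose[OF bounded_linear_mult_right[of c]]) auto
  finally have "eta2 (\<lambda>p. c *\<^sub>R v p) p = c * eta2 v p"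
    using D1[OF assms(3) bounded_linear_fst] by (simp add: eta2_eq algebra_simps)
  with e1[OF assms(3)] show ?thesis by (simp add: prol2_eq)
qed

text \<open>The bracket relations hold on \<open>U\<close> only, while prolongation differentiates
  its argument; since \<open>U\<close> is open, the values there determine the result.\<close>

lemma prol2_cong:
  assumes "open U" "\<And>p. p \<in> U \<Longrightarrow> v p = w p" "base (jet1 p) \<in> U"
  shows "prol2 v p = prol2 w p"
proof -
  have D1: "D1 (\<lambda>p. L (v p)) q = D1 (\<lambda>p. L (w p)) q"
    if "base q \<in> U" for q and L :: "R2 \<Rightarrow> real"
    unfolding D1_eq
    by (subst frechet_derivative_cong_open[OF assms(1) that]) (auto simp: assms(2))
  have e1: "eta1 v q = eta1 w q" if "base q \<in> U" for q
    using D1[OF that] by (simp add: eta1_eq)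
  have "D2 (eta1 v) p = D2 (eta1 w) p"
    unfolding D2_eq
    by (subst frechet_derivative_cong_open[OF open_vimage_base[OF assms(1)], of "jet1 p"]) (auto intro: e1 assms(3))
  then have "eta2 v p = eta2 w p"
    using D1[OF assms(3)] by (simp add: eta2_eq)
  with e1[OF assms(3)] show ?thesis by (simp add: prol2_eq assms)
qed

text \<open>In the first three components this is the commutator with the total derivative, valid
  for any prolonged field. The last one says X \<phi> = A(eta2) - \<phi> D\<xi>, which is the
  invariance condition: on u3 = \<phi> the total derivative inside \<open>eta3\<close> is
  differentiation along \<open>A\<close>.\<close>

lemma lie_point_symmetry_bracket:
  assumes "open U" "smooth_on U v" "open M" "smooth_on M \<phi>" "p \<in> M" "base (jet1 p) \<in> U"
    and "lie_point_symmetry M \<phi> v"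
  shows "lie_bracket (prol2 v) (ode3_field \<phi>) p = (- D1 (\<lambda>p. fst (v p)) (jet1 p)) *\<^sub>R ode3_field \<phi> p"
proof -
  obtain x u u1 u2 where p: "p = (x, u, u1, u2)" by (cases p) auto
  have dphi: "\<phi> differentiable (at p)"
    using assms smooth_on_differentiable by blast
  \<comment> \<open>Dropping \<open>u3\<close> exhibits the defining function of the equation as a
    linear coordinate minus a composite with \<phi>.\<close>
  define tr :: "R5 \<Rightarrow> R4" where "tr r = (fst r, fst (snd r), fst (snd (snd r)), fst (snd (snd (snd r))))" for r
  have tr: "bounded_linear tr"
    unfolding tr_def[abs_def]
    by (intro bounded_linear_Pair bounded_linear_compose[OF bounded_linear_fst] bounded_linear_compose[OF bounded_linear_snd]
       bounded_linear_fst bounded_linear_snd)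
  have last: "bounded_linear (\<lambda>r::R5. snd (snd (snd (snd r))))"
    by (intro bounded_linear_compose[OF bounded_linear_snd] bounded_linear_snd)
  let ?r = "(x, u, u1, u2, \<phi> p)"
  have trr: "tr ?r = p" by (simp add: tr_def p)
  have dtr: "\<phi> differentiable (at (tr ?r))" using dphi trr by simp
  have "((\<lambda>(x, u, u1, u2, u3). u3 - \<phi> (x, u, u1, u2)) :: R5 \<Rightarrow> real) = (\<lambda>r. snd (snd (snd (snd r))) - \<phi> (tr r))"
    by (auto simp: fun_eq_iff tr_def)
  moreover have d: "((\<lambda>r. snd (snd (snd (snd r))) - \<phi> (tr r)) has_derivative
      (\<lambda>h. snd (snd (snd (snd h))) - frechet_derivative \<phi> (at (tr ?r)) (tr h))) (at ?r)"
    by (intro has_derivative_diff bounded_linear_imp_has_derivative[OF last]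
        has_derivative_compose[OF bounded_linear_imp_has_derivative[OF tr] frechet_derivative_works[THEN iffD1, OF dtr]])
  ultimately have "lie_deriv (prol3 v) (\<lambda>(x, u, u1, u2, u3). u3 - \<phi> (x, u, u1, u2)) ?r =
      snd (snd (snd (snd (prol3 v ?r)))) - frechet_derivative \<phi> (at (tr ?r)) (tr (prol3 v ?r))"
    unfolding lie_deriv_def by (simp only: frechet_derivative_at[OF d, symmetric])
  moreover have "lie_deriv (prol3 v) (\<lambda>(x, u, u1, u2, u3). u3 - \<phi> (x, u, u1, u2)) ?r = 0"
    using assms(5,7) unfolding lie_point_symmetry_def p by auto
  moreover have "tr (prol3 v ?r) = prol2 v p"
    by (simp add: tr_def p)
  ultimately have "eta3 v ?r = frechet_derivative \<phi> (at p) (prol2 v p)"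
    by (simp add: trr)
  then have e3: "frechet_derivative \<phi> (at p) (prol2 v p) =
     frechet_derivative (eta2 v) (at p) (ode3_field \<phi> p) - \<phi> p * D1 (\<lambda>p. fst (v p)) (jet1 p)"
    by (simp add: p comp_def)
  have bl2: "bounded_linear (\<lambda>p::R4. fst (snd (snd p)))" "bounded_linear (\<lambda>p::R4. snd (snd (snd p)))"
    by (intro bounded_linear_compose[OF bounded_linear_snd] bounded_linear_compose[OF bounded_linear_fst]
        bounded_linear_snd bounded_linear_fst)+
  have "((ode3_field \<phi>) has_derivative
      (\<lambda>h. (0, fst (snd (snd h)), snd (snd (snd h)), frechet_derivative \<phi> (at p) h))) (at p)"
    unfolding ode3_field_eq
    by (intro has_derivative_Pair has_derivative_const bounded_linear_imp_has_derivative[OF bl2(1)]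
      bounded_linear_imp_has_derivative[OF bl2(2)] frechet_derivative_works[THEN iffD1, OF dphi])
  from frechet_derivative_at[OF this, symmetric] have dA: "lie_deriv (prol2 v) (ode3_field \<phi>) p =
      (0, fst (snd (snd (prol2 v p))), snd (snd (snd (prol2 v p))), frechet_derivative \<phi> (at p) (prol2 v p))"
    unfolding lie_deriv_def by (rule fun_cong)
  have b: "base (jet1 (ode3_field \<phi> p)) = (1, snd (snd (jet1 p)))" "jet1 (ode3_field \<phi> p) = (1, snd (snd p))"
    by (simp_all add: p base_def)
  show ?thesis
    unfolding lie_bracket_def dA lie_deriv_def[of "ode3_field \<phi>"] frechet_derivative_prol2[OF assms(1,2,6)] e3 b
    by (simp add: prol2_eq ode3_field_eq)
      (simp add: D1_eq D2_eq eta1_eq eta2_eq p base_def)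
qed

text \<open>\<open>D1 f\<close> is affine in \<open>u1\<close> with slope f_u. This and the analogue
  for \<open>D2\<close> give the entries of the Jacobian of the reduced variables along
  \<open>u1\<close> and \<open>u2\<close>.\<close>

lemma frechet_derivative_D1_vertical:
  assumes "open U" "smooth_on U f" "base q \<in> U"
  shows "frechet_derivative (D1 f) (at q) (0, 0, 1) = frechet_derivative f (at (base q)) (0, 1)"
proof -
  have bl: "bounded_linear (\<lambda>q::R3. snd (snd q))"
    by (intro bounded_linear_compose[OF bounded_linear_snd] bounded_linear_snd)
  note d = has_derivative_directional_derivative[OF assms bounded_linear_imp_has_derivative[OF bounded_linear_base]
      has_derivative_Pair[OF has_derivative_const[of 1] bounded_linear_imp_has_derivative[OF bl]]]
  have "frechet_derivative (\<lambda>q'. frechet_derivative f (at q') h) (at (base q)) (0, 0) = 0" for h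
    using linear_0[OF linear_frechet_derivative[OF smooth_on_differentiable[OF
          smooth_on_frechet_derivative[OF assms(2)] assms(3)]], of h]
    by (simp add: zero_prod_def)
  then show ?thesis
    using fun_cong[OF frechet_derivative_at[OF d], of "(0, 0, 1)"]
    by (simp add: D1_eq base_def)
qed

lemma frechet_derivative_D2_vertical:
  assumes "open Q" "smooth_on Q f" "jet1 p \<in> Q"
  shows "frechet_derivative (D2 f) (at p) (0, 0, 0, 1) = frechet_derivative f (at (jet1 p)) (0, 0, 1)"
proof -
  have bl: "bounded_linear (\<lambda>q::R4. snd (snd q))"
    by (intro bounded_linear_compose[OF bounded_linear_snd] bounded_linear_snd)
  note d = has_derivative_directional_derivative[OF assms bounded_linear_imp_has_derivative[OF bounded_linear_jet1]
      has_derivative_Pair[OF has_derivative_const[of 1] bounded_linear_imp_has_derivative[OF bl]]]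
  have "frechet_derivative (\<lambda>q'. frechet_derivative f (at q') h) (at (jet1 p)) (0, 0, 0) = 0" for h
    using linear_0[OF linear_frechet_derivative[OF smooth_on_differentiable[OF
          smooth_on_frechet_derivative[OF assms(2)] assms(3)]], of h]
    by (simp add: zero_prod_def)
  then show ?thesis
    using fun_cong[OF frechet_derivative_at[OF d], of "(0, 0, 0, 1)"]
    by (simp add: D2_eq jet1_eq)
qed

section \<open>Functional independence\<close>

text \<open>Four independent vectors span the four-dimensional space: forming combinations is an
  injective, hence surjective, linear map.\<close>

lemma lin_indep4_frame:
  fixes p q r s :: R4 and L :: "R4 \<Rightarrow> real"
  assumes "lin_indep4 p q r s" "linear L" "L p = 0" "L q = 0" "L r = 0" "L s = 0"
  shows "L h = 0"
proof -
  define T :: "R4 \<Rightarrow> R4" where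
    "T z = fst z *\<^sub>R p + fst (snd z) *\<^sub>R q + fst (snd (snd z)) *\<^sub>R r + snd (snd (snd z)) *\<^sub>R s" for z
  have T: "linear T"
    by (rule linearI) (simp_all add: T_def algebra_simps)
  have "inj T"
    using assms(1) unfolding linear_injective_0[OF T] lin_indep4_def T_def
    by (metis (no_types, lifting) prod.collapse zero_prod_def)
  then have "surj T"
    using T linear_injective_imp_surjective by blast
  then obtain z where "h = T z" by blast
  then show ?thesis
    using assms by (simp add: T_def linear_add linear_cmul)
qed

text \<open>Back substitution in an anti-triangular system: \<open>c\<close> fixes the first
  coordinate, \<open>b\<close> corrects the second, \<open>a\<close> the third.\<close>

lemma surj_R3I:
  fixes T :: "'a::real_vector \<Rightarrow> R3"
  assumes "linear T" "T a = (0, 0, t1)" "T b = (0, t2, r1)" "T c = (t3, r2, r3)"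
    and "t1 \<noteq> 0" "t2 \<noteq> 0" "t3 \<noteq> 0"
  shows "surj T"
proof (rule surjI)
  fix z :: R3
  let ?c = "fst z / t3"
  let ?b = "(fst (snd z) - ?c * r2) / t2"
  let ?a = "(snd (snd z) - ?c * r3 - ?b * r1) / t1"
  show "T (?a *\<^sub>R a + ?b *\<^sub>R b + ?c *\<^sub>R c) = z"
    using assms(2-) by (simp add: linear_add[OF assms(1)] linear_cmul[OF assms(1)] prod_eq_iff)
qed

lemma functionally_independent_onI:
  fixes f :: "'a::euclidean_space \<Rightarrow> 'b::euclidean_space"
  assumes "smooth_on S f"
    and "\<And>B. open B \<Longrightarrow> B \<noteq> {} \<Longrightarrow> B \<subseteq> S \<Longrightarrow> \<exists>p\<in>B. surj (frechet_derivative f (at p))"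
  shows "functionally_independent_on S f"
  unfolding functionally_independent_on_def
proof (rule notI, elim exE conjE)
  fix B W and G :: "'b \<Rightarrow> real"
  assume B: "open B" "B \<noteq> {}" "B \<subseteq> S" and W: "f ` B \<subseteq> W"
    and nz: "\<forall>W'. open W' \<and> W' \<noteq> {} \<and> W' \<subseteq> W \<longrightarrow> (\<exists>z\<in>W'. G z \<noteq> 0)"
    and G: "\<forall>p\<in>B. G (f p) = 0"
  obtain p where p: "p \<in> B" "surj (frechet_derivative f (at p))"
    using assms(2)[OF B] by blast
  have d: "(f has_derivative frechet_derivative f (at p)) (at p)"
    using smooth_on_has_derivative[OF assms(1)] p B by blast
  then obtain g' where g': "linear g'" "frechet_derivative f (at p) \<circ> g' = id"
    using p(2) linear_surjective_right_inverse has_derivative_linear by blast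
  have "continuous_on B f"
    using smooth_on_continuous_on[OF assms(1)] B(3) by (rule continuous_on_subset)
  moreover have "bounded_linear g'"
    using g'(1) by (simp add: linear_conv_bounded_linear)
  moreover have "p \<in> interior B" using B(1) p(1) by (simp add: interior_open)
  \<comment> \<open>A right inverse of the differential at the single point \<open>p\<close> makes
    \<open>f p\<close> an interior value; on the open set of interior values, contained in
    \<open>W\<close>, \<open>G\<close> cannot vanish identically.\<close>
  ultimately have "f p \<in> interior (f ` B)"
    using sussmann_open_mapping[where T = B, OF B(1) _ p(1) d _ g'(2) order_refl] by blast
  then have "\<exists>z\<in>interior (f ` B). G z \<noteq> 0"
    using nz W interior_subset by (metis empty_iff open_interior order_trans)
  then show False using G interior_subset by blast
qed

text \<open>If \<open>[X, Y] = k Z\<close> and \<open>[Z, Y] = e Y\<close>, then \<open>f = Y J\<close> is an \<open>e\<close>-eigenfunction of \<open>Z\<close>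
  annihilated by \<open>X\<close>; where also \<open>Y f = 0\<close>, it is annihilated by \<open>[X, Y]\<close>, hence zero.\<close>

lemma lie_deriv_eigenfunction:
  fixes J :: "'a::euclidean_space \<Rightarrow> real"
  assumes S: "open S" and sm: "smooth_on S J" "smooth_on S X" "smooth_on S Y" "smooth_on S Z" "smooth_on S A"
    and J: "\<And>p. p \<in> S \<Longrightarrow> lie_deriv A J p = 0" "\<And>p. p \<in> S \<Longrightarrow> lie_deriv X J p = 0"
      "\<And>p. p \<in> S \<Longrightarrow> lie_deriv Z J p = 0"
    and br: "\<And>p. p \<in> S \<Longrightarrow> lie_bracket Y A p = c p *\<^sub>R A p"
      "\<And>p. p \<in> S \<Longrightarrow> lie_bracket X Y p = k *\<^sub>R Z p"
      "\<And>p. p \<in> S \<Longrightarrow> lie_bracket Z Y p = e *\<^sub>R Y p"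
  shows "p \<in> S \<Longrightarrow> lie_deriv A (lie_deriv Y J) p = 0"
    and "p \<in> S \<Longrightarrow> lie_deriv X (lie_deriv Y J) p = 0"
    and "p \<in> S \<Longrightarrow> lie_deriv Z (lie_deriv Y J) p = e * lie_deriv Y J p"
    and "\<lbrakk>k \<noteq> 0; e \<noteq> 0; \<And>p. p \<in> S \<Longrightarrow> lie_deriv Y J p \<noteq> 0; open B; B \<noteq> {}; B \<subseteq> S\<rbrakk> \<Longrightarrow>
      \<exists>p\<in>B. lie_deriv Y (lie_deriv Y J) p \<noteq> 0"
proof -
  let ?f = "lie_deriv Y J"
  have zero: "lie_deriv V h p = 0" if "open B" "p \<in> B" "\<And>p. p \<in> B \<Longrightarrow> h p = 0"
    for V :: "'a \<Rightarrow> 'a" and h :: "'a \<Rightarrow> real" and B p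
    using lie_deriv_cong_open[OF that(1,2), of h "\<lambda>_. 0" V] that(3) by (simp add: lie_deriv_def)
  \<comment> \<open>Each bracket in use is a multiple of a known field \<open>R\<close>, namely
    \<open>A\<close>, \<open>Z\<close> or \<open>Y\<close>, so interchanging two derivatives costs a
    multiple of the derivative along \<open>R\<close>.\<close>
  have cm: "lie_deriv V (lie_deriv W h) p = lie_deriv W (lie_deriv V h) p + r * lie_deriv R h p"
    if "smooth_on S h" "smooth_on S V" "smooth_on S W" "p \<in> S" "lie_bracket V W p = r *\<^sub>R R p"
    for V W R :: "'a \<Rightarrow> 'a" and h :: "'a \<Rightarrow> real" and r p
  proof -
    have "linear (frechet_derivative h (at p))"
      by (rule linear_frechet_derivative[OF smooth_on_differentiable[OF that(1,4)]])
    then show ?thesis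
      using lie_deriv_commute[OF S that(1) smooth_on_differentiable[OF that(2,4)]
          smooth_on_differentiable[OF that(3,4)] that(4)] that(5)
      by (simp add: lie_deriv_def linear_cmul)
  qed
  have f: "smooth_on S ?f"
    by (rule smooth_on_lie_deriv[OF S sm(1,3)])
  show 1: "lie_deriv A ?f p = 0" if "p \<in> S" for p
    using cm[where R = A, OF sm(1,3,5) that br(1)[OF that]] zero[OF S that J(1)] J(1)[OF that] by simp
  show 2: "lie_deriv X ?f p = 0" if "p \<in> S" for p
    using cm[where R = Z, OF sm(1,2,3) that br(2)[OF that]] zero[OF S that J(2)] J(3)[OF that] by simp
  show 3: "lie_deriv Z ?f p = e * ?f p" if "p \<in> S" for p
    using cm[where R = Y, OF sm(1,4,3) that br(3)[OF that]] zero[OF S that J(3)] by simp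
  show "\<exists>p\<in>B. lie_deriv Y ?f p \<noteq> 0"
    if "k \<noteq> 0" "e \<noteq> 0" "\<And>p. p \<in> S \<Longrightarrow> ?f p \<noteq> 0" "open B" "B \<noteq> {}" "B \<subseteq> S"
  proof (rule ccontr)
    assume n: "\<not> ?thesis"
    obtain p where p: "p \<in> B" "p \<in> S" using \<open>B \<noteq> {}\<close> \<open>B \<subseteq> S\<close> by blast
    have "lie_deriv X (lie_deriv Y ?f) p = 0" by (rule zero[OF that(4) p(1)]) (use n in auto)
    moreover have "lie_deriv Y (lie_deriv X ?f) p = 0" by (rule zero[OF S p(2) 2])
    ultimately show False
      using cm[where R = Z, OF f sm(2,3) p(2) br(2)[OF p(2)]] 3[OF p(2)] that(1-3) p(2) by auto
  qed
qed

section \<open>The reduced equation\<close>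

lemma alpha1_eq: "alpha1 y \<alpha> = (\<lambda>q. D1 \<alpha> q / D1 y q)"
  by (auto simp: fun_eq_iff)

lemma alpha2_eq: "alpha2 y \<alpha> = (\<lambda>p. D2 (alpha1 y \<alpha>) p / D1 y (jet1 p))"
  by (auto simp: fun_eq_iff)

lemma reduced_vars_eq:
  "reduced_vars y \<alpha> = (\<lambda>p. (y (base (jet1 p)), alpha1 y \<alpha> (jet1 p), alpha2 y \<alpha> p))"
  by (auto simp: fun_eq_iff reduced_vars_def base_def)

lemma base_reduced_vars: "base (reduced_vars y \<alpha> p) = (y (base (jet1 p)), alpha1 y \<alpha> (jet1 p))"
  by (simp add: reduced_vars_eq base_def)

text \<open>Collects the hypotheses that involve only \<open>v3\<close>, so that each result serves
  both remaining symmetries and both first integrals.\<close>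

locale reduced_ode =
  fixes U V :: "R2 set" and M :: "R4 set" and N :: "R3 set" and \<phi> :: "R4 \<Rightarrow> real"
    and v3 g :: "R2 \<Rightarrow> R2" and y \<alpha> :: "R2 \<Rightarrow> real" and \<psi> :: "R3 \<Rightarrow> real"
  assumes U: "open U" and M: "open M" "jet0 ` M \<subseteq> U" "smooth_on M \<phi>"
    and v3: "smooth_on U v3" and red: "reduction U M \<phi> v3 V y \<alpha> g N \<psi>"
begin

abbreviation "r \<equiv> reduced_vars y \<alpha>"

text \<open>An open set of first-order jets, containing those of \<open>M\<close>, on which the
  denominator of \<alpha>1 and \<alpha>2 does not vanish.\<close>

definition "Q = {q \<in> base -` U. D1 y q \<noteq> 0}"

lemma smooth_change: "smooth_on U (\<lambda>p. (y p, \<alpha> p))"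
  using red by (simp add: reduction_def diffeomorphism_between_def)

lemma smooth_y: "smooth_on U y" and smooth_alpha: "smooth_on U \<alpha>"
  using smooth_on_fst[OF U smooth_change] smooth_on_snd[OF U smooth_change] by simp_all

lemma open_Q: "open Q"
proof -
  have "continuous_on (base -` U) (D1 y)"
    by (rule smooth_on_continuous_on[OF smooth_on_D1[OF U smooth_y]])
  from continuous_on_open_vimage[OF open_vimage_base[OF U], THEN iffD1, OF this, rule_format, of "- {0}"]
  have "open (D1 y -` (- {0}) \<inter> base -` U)" by auto
  moreover have "D1 y -` (- {0}) \<inter> base -` U = Q" by (auto simp: Q_def)
  ultimately show ?thesis by simp
qed

lemma jet1_in_Q: "p \<in> M \<Longrightarrow> jet1 p \<in> Q"
  using M(2) red unfolding Q_def reduction_def by (auto simp: base_jet1)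

lemma in_U: "q \<in> Q \<Longrightarrow> base q \<in> U"
  by (simp add: Q_def)

lemma smooth_D1_y: "smooth_on Q (D1 y)" and smooth_D1_alpha: "smooth_on Q (D1 \<alpha>)"
  using smooth_on_D1[OF U smooth_y] smooth_on_D1[OF U smooth_alpha]
  by (auto intro: smooth_on_subset simp: Q_def)

lemma smooth_alpha1: "smooth_on Q (alpha1 y \<alpha>)"
  unfolding alpha1_eq
  by (intro smooth_on_divide open_Q smooth_D1_y smooth_D1_alpha) (simp add: Q_def)

lemma smooth_alpha2: "smooth_on (jet1 -` Q) (alpha2 y \<alpha>)"
  unfolding alpha2_eq
  by (intro smooth_on_divide open_vimage_jet1 open_Q smooth_on_D2 smooth_alpha1
      smooth_on_compose_jet1 smooth_D1_y) (simp add: Q_def)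

lemma smooth_reduced_vars: "smooth_on (jet1 -` Q) r"
  unfolding reduced_vars_eq
proof (intro smooth_on_Pair open_vimage_jet1 open_Q smooth_alpha2 smooth_on_compose_jet1 smooth_alpha1)
  show "smooth_on Q (\<lambda>q. y (base q))"
    by (rule smooth_on_subset[OF smooth_on_compose_base[OF U smooth_y]]) (auto simp: in_U)
qed

lemma lie_deriv_reduced_vars:
  assumes "jet1 p \<in> Q"
  shows "lie_deriv X r p = (frechet_derivative y (at (base (jet1 p))) (base (jet1 (X p))),
    frechet_derivative (alpha1 y \<alpha>) (at (jet1 p)) (jet1 (X p)), lie_deriv X (alpha2 y \<alpha>) p)"
proof -
  have d: "y differentiable (at (base (jet1 p)))" "alpha1 y \<alpha> differentiable (at (jet1 p))"
     "alpha2 y \<alpha> differentiable (at p)"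
    using smooth_on_differentiable smooth_y smooth_alpha1 smooth_alpha2 assms in_U by blast+
  note d' = d(3) differentiable_compose_jet1[OF d(2)]
    differentiable_compose_jet1[of "\<lambda>q. y (base q)", OF differentiable_compose_base[OF d(1)]]
  show ?thesis
    unfolding lie_deriv_def reduced_vars_eq
    by (simp add: frechet_derivative_Pair differentiable_Pair d'
      frechet_derivative_compose_bounded_linear[OF bounded_linear_jet1 d(2)]
      frechet_derivative_compose_bounded_linear[where f = y, OF bounded_linear_compose[OF bounded_linear_base bounded_linear_jet1] d(1)])
qed

lemma lie_deriv_reduced:
  assumes "smooth_on N I" "p \<in> M"
  shows "lie_deriv X (I \<circ> r) p = frechet_derivative I (at (r p)) (lie_deriv X r p)"
proof -
  have N: "r p \<in> N" using red assms(2) by (auto simp: reduction_def)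
  have d: "r differentiable (at p)"
    using smooth_on_differentiable[OF smooth_reduced_vars] jet1_in_Q[OF assms(2)] by blast
  show ?thesis
    unfolding lie_deriv_def comp_def
    by (simp add: frechet_derivative_chain[OF d smooth_on_differentiable[OF assms(1) N]])
qed

lemma smooth_reduced:
  assumes "smooth_on N I"
  shows "smooth_on M (I \<circ> r)"
proof -
  have "smooth_on M r"
    by (rule smooth_on_subset[OF smooth_reduced_vars]) (use jet1_in_Q in blast)
  moreover have "r ` M \<subseteq> N" using red by (auto simp: reduction_def)
  ultimately show ?thesis
    unfolding comp_def by (rule smooth_on_compose[OF M(1) assms])
qed

text \<open>Along solutions the field acts as D_x = (D_x y) D_y, sending y, \<alpha>1, \<alpha>2 to
  D_x y times 1, \<alpha>2, \<alpha>3; on the equation \<alpha>3 equals \<psi>.\<close>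

lemma ode3_field_reduced_vars:
  assumes "p \<in> M"
  shows "lie_deriv (ode3_field \<phi>) r p = D1 y (jet1 p) *\<^sub>R ode2_field \<psi> (r p)"
proof -
  obtain x u u1 u2 where p: "p = (x, u, u1, u2)" by (cases p) auto
  have nz: "D1 y (jet1 p) \<noteq> 0" using jet1_in_Q[OF assms] by (simp add: Q_def)
  have "alpha3 y \<alpha> (x, u, u1, u2, \<phi> p) = \<psi> (r p)"
    using red assms unfolding reduction_def p by auto
  then have "lie_deriv (ode3_field \<phi>) (alpha2 y \<alpha>) p = D1 y (jet1 p) * \<psi> (r p)"
    using nz by (simp add: p lie_deriv_def field_simps)
  moreover have "jet1 (ode3_field \<phi> p) = (1, snd (snd p))" "base (jet1 (ode3_field \<phi> p)) = (1, snd (snd (jet1 p)))"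
    by (simp_all add: p base_def)
  ultimately show ?thesis
    unfolding lie_deriv_reduced_vars[OF jet1_in_Q[OF assms]]
    using nz by (simp add: D1_eq[symmetric] D2_eq[symmetric] alpha2_eq reduced_vars_eq)
      (simp add: D1_eq D2_eq)
qed

text \<open>The terms in D_x \<xi> coming from numerator and denominator cancel in the quotient
  rule, leaving the prolongation formula in the variables (y, \<alpha>).\<close>

lemma prol1_alpha1:
  assumes "smooth_on U v" "q \<in> Q"
  shows "lie_deriv (prol1 v) (alpha1 y \<alpha>) q =
    (D1 (lie_deriv v \<alpha>) q - alpha1 y \<alpha> q * D1 (lie_deriv v y) q) / D1 y q"
proof -
  have d: "D1 y differentiable (at q)" "D1 \<alpha> differentiable (at q)" "D1 y q \<noteq> 0"
    using smooth_on_differentiable[OF smooth_D1_y assms(2)] smooth_on_differentiable[OF smooth_D1_alpha assms(2)] assms(2)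
    by (auto simp: Q_def)
  show ?thesis
    unfolding alpha1_eq
    using d(3) by (simp add: lie_deriv_divide d prol1_D1[OF U smooth_y assms(1) in_U[OF assms(2)]]
       prol1_D1[OF U smooth_alpha assms(1) in_U[OF assms(2)]]) (simp add: d(3) field_simps)
qed

lemma prol2_alpha2:
  assumes "smooth_on U v" "jet1 p \<in> Q"
  shows "lie_deriv (prol2 v) (alpha2 y \<alpha>) p =
    (D2 (lie_deriv (prol1 v) (alpha1 y \<alpha>)) p - alpha2 y \<alpha> p * D1 (lie_deriv v y) (jet1 p)) / D1 y (jet1 p)"
proof -
  have p: "p \<in> jet1 -` Q" using assms by simp
  have d: "D1 y differentiable (at (jet1 p))" "D2 (alpha1 y \<alpha>) differentiable (at p)" "D1 y (jet1 p) \<noteq> 0"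
    using smooth_on_differentiable[OF smooth_D1_y assms(2)] smooth_on_differentiable[OF smooth_on_D2[OF open_Q smooth_alpha1] p] assms(2)
    by (auto simp: Q_def)
  show ?thesis
    unfolding alpha2_eq
    using d(3) by (simp add: lie_deriv_divide d differentiable_compose_jet1 lie_deriv_compose_jet1[where Y = "prol1 v"] jet1_prol2
         prol1_D1[OF U smooth_y assms(1) in_U[OF assms(2)]]
       prol2_D2[OF U assms(1) open_Q smooth_alpha1 assms(2) in_U[OF assms(2)]]) (simp add: d(3) field_simps)
qed

lemma prol2_reduced_vars:
  assumes "smooth_on U v" "jet1 p \<in> Q"
  shows "lie_deriv (prol2 v) r p = (lie_deriv v y (base (jet1 p)),
    lie_deriv (prol1 v) (alpha1 y \<alpha>) (jet1 p), lie_deriv (prol2 v) (alpha2 y \<alpha>) p)"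
  unfolding lie_deriv_reduced_vars[OF assms(2)]
  by (simp add: jet1_prol2 base_prol1 lie_deriv_def)

text \<open>v3 y = 0 and v3 \<alpha> = 1 are constants, so their total derivatives vanish, and the
  prolongation formulas make \<alpha>1 and \<alpha>2 invariant.\<close>

lemma prol2_v3_reduced_vars:
  assumes "p \<in> M"
  shows "lie_deriv (prol2 v3) r p = 0"
proof -
  have v3U: "lie_deriv v3 y p = 0" "lie_deriv v3 \<alpha> p = 1" if "p \<in> U" for p
  proof -
    have "lie_deriv v3 (\<lambda>p. (y p, \<alpha> p)) p = (0, 1)"
      using red that by (simp add: reduction_def pushes_to_def)
    moreover have "y differentiable (at p)" "\<alpha> differentiable (at p)"
      using smooth_on_differentiable smooth_y smooth_alpha that by blast+
    ultimately show "lie_deriv v3 y p = 0" "lie_deriv v3 \<alpha> p = 1"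
      by (simp_all add: lie_deriv_def frechet_derivative_Pair)
  qed
  have D1: "D1 (lie_deriv v3 y) q = 0" "D1 (lie_deriv v3 \<alpha>) q = 0" if "q \<in> Q" for q
    unfolding D1_eq using in_U[OF that]
      frechet_derivative_cong_open[OF U, of "base q" "lie_deriv v3 y" "\<lambda>_. 0"]
      frechet_derivative_cong_open[OF U, of "base q" "lie_deriv v3 \<alpha>" "\<lambda>_. 1"] v3U by simp_all
  have a1: "lie_deriv (prol1 v3) (alpha1 y \<alpha>) q = 0" if "q \<in> Q" for q
    by (simp add: prol1_alpha1[OF v3 that] D1[OF that])
  note q = jet1_in_Q[OF assms]
  have "D2 (lie_deriv (prol1 v3) (alpha1 y \<alpha>)) p = 0"
    unfolding D2_eq using frechet_derivative_cong_open[OF open_Q q a1] by simp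
  then show ?thesis
    by (simp add: prol2_reduced_vars[OF v3 q] prol2_alpha2[OF v3 q] a1[OF q] D1[OF q]
       v3U(1)[OF in_U[OF q]] zero_prod_def)
qed

text \<open>On the directions of \<open>u2\<close>, \<open>u1\<close> and the field of the equation
  the differential is anti-triangular, with entries K/D^3, K/D^2 and D, where D = D_x y and
  \<open>K\<close> is the Jacobian determinant of (y, \<alpha>).\<close>

lemma surj_reduced_vars:
  assumes "p \<in> M"
  shows "surj (frechet_derivative r (at p))"
proof -
  let ?b = "base (jet1 p)" and ?D = "D1 y (jet1 p)"
  note q = jet1_in_Q[OF assms]
  note b = in_U[OF q]
  have p: "p \<in> jet1 -` Q" using q by simp
  have nz: "?D \<noteq> 0" using q by (simp add: Q_def)
  \<comment> \<open>Equal to y_x \<alpha>_u - \<alpha>_x y_u: the \<open>u1\<close> terms of the two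
    total derivatives cancel.\<close>
  define K where "K = frechet_derivative \<alpha> (at ?b) (0, 1) * ?D - D1 \<alpha> (jet1 p) * frechet_derivative y (at ?b) (0, 1)"
  have dy: "y differentiable (at ?b)" and da: "\<alpha> differentiable (at ?b)"
    using smooth_on_differentiable smooth_y smooth_alpha b by blast+
  have "K \<noteq> 0"
  proof
    assume K: "K = 0"
    define c where "c = frechet_derivative y (at ?b) (0, 1)"
    \<comment> \<open>If \<open>K\<close> vanished, the differential of (y, \<alpha>) would kill
      this nonzero vector, contradicting the left inverse \<open>g\<close>.\<close>
    define h :: R2 where "h = ?D *\<^sub>R (0, 1) - c *\<^sub>R (1, snd (snd (jet1 p)))"
    have lin: "frechet_derivative f (at ?b) h = ?D * frechet_derivative f (at ?b) (0, 1) - c * D1 f (jet1 p)"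
      if "f differentiable (at ?b)" for f :: "R2 \<Rightarrow> real"
      unfolding h_def D1_eq[of f] using linear_frechet_derivative[OF that]
      by (simp only: linear_diff linear_cmul real_scaleR_def)
    have g: "homeomorphism U V (\<lambda>p. (y p, \<alpha> p)) g" "smooth_on V g"
      using red by (auto simp: reduction_def diffeomorphism_between_def)
    have "(y ?b, \<alpha> ?b) \<in> V" using g(1) b by (auto simp: homeomorphism_def)
    from frechet_derivative_chain[OF smooth_on_differentiable[OF smooth_change b] smooth_on_differentiable[OF g(2) this]]
    have "frechet_derivative (\<lambda>p. g (y p, \<alpha> p)) (at ?b) h =
        frechet_derivative g (at (y ?b, \<alpha> ?b)) (frechet_derivative y (at ?b) h, frechet_derivative \<alpha> (at ?b) h)"
      by (simp add: frechet_derivative_Pair[OF dy da])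
    moreover have "frechet_derivative (\<lambda>p. g (y p, \<alpha> p)) (at ?b) = (\<lambda>h. h)"
      using frechet_derivative_cong_open[OF U b, of "\<lambda>p. g (y p, \<alpha> p)" "\<lambda>p. p"] g(1)
      by (simp add: homeomorphism_def)
    moreover have "frechet_derivative y (at ?b) h = 0" "frechet_derivative \<alpha> (at ?b) h = 0"
      using K by (simp_all add: lin dy da c_def K_def algebra_simps)
    moreover have "frechet_derivative g (at (y ?b, \<alpha> ?b)) (0, 0) = 0"
      using linear_0[OF linear_frechet_derivative[OF smooth_on_differentiable[OF g(2) \<open>(y ?b, \<alpha> ?b) \<in> V\<close>]]]
      by (simp add: zero_prod_def)
    ultimately have "h = 0" by simp
    then show False using nz by (simp add: h_def prod_eq_iff)
  qed
  have vert: "jet1 (0, 0, 0, 1) = 0" "base (jet1 (0, 0, 1, 0)) = 0" "jet1 (0, 0, 1, 0) = (0, 0, 1)"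
    by (simp_all add: base_def zero_prod_def)
  have r': "frechet_derivative r (at p) h = (frechet_derivative y (at ?b) (base (jet1 h)),
    frechet_derivative (alpha1 y \<alpha>) (at (jet1 p)) (jet1 h), frechet_derivative (alpha2 y \<alpha>) (at p) h)" for h
    using lie_deriv_reduced_vars[OF q, of "\<lambda>_. h"] by (simp add: lie_deriv_def)
  have d1: "D1 y differentiable (at (jet1 p))" "D1 \<alpha> differentiable (at (jet1 p))" "alpha1 y \<alpha> differentiable (at (jet1 p))"
    using smooth_on_differentiable smooth_D1_y smooth_D1_alpha smooth_alpha1 q by blast+
  have a1: "frechet_derivative (alpha1 y \<alpha>) (at (jet1 p)) (0, 0, 1) = K / (?D * ?D)"
    unfolding alpha1_eq K_def
    by (simp add: frechet_derivative_divide d1 nz frechet_derivative_D1_vertical[OF U _ b] smooth_y smooth_alpha)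
  have "D2 (alpha1 y \<alpha>) differentiable (at p)"
    by (rule smooth_on_differentiable[OF smooth_on_D2[OF open_Q smooth_alpha1] p])
  moreover have "frechet_derivative (\<lambda>p. D1 y (jet1 p)) (at p) (0, 0, 0, 1) = 0"
    by (simp add: frechet_derivative_compose_bounded_linear[OF bounded_linear_jet1 d1(1)] vert
        linear_0[OF linear_frechet_derivative[OF d1(1)]] del: jet1.simps)
  ultimately have a2: "frechet_derivative (alpha2 y \<alpha>) (at p) (0, 0, 0, 1) = K / (?D * ?D) / ?D"
    unfolding alpha2_eq using nz
    by (simp add: frechet_derivative_divide differentiable_compose_jet1[OF d1(1)]
        frechet_derivative_D2_vertical[OF open_Q smooth_alpha1 q] a1)
  have 1: "frechet_derivative r (at p) (0, 0, 0, 1) = (0, 0, K / (?D * ?D) / ?D)"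
    unfolding r' vert a2
    using linear_0[OF linear_frechet_derivative[OF d1(3)]] linear_0[OF linear_frechet_derivative[OF dy]]
    by (simp add: base_def zero_prod_def)
  have 2: "frechet_derivative r (at p) (0, 0, 1, 0) =
      (0, K / (?D * ?D), frechet_derivative (alpha2 y \<alpha>) (at p) (0, 0, 1, 0))"
    unfolding r' vert a1 using linear_0[OF linear_frechet_derivative[OF dy]]
    by (simp add: base_def zero_prod_def)
  have 3: "frechet_derivative r (at p) (ode3_field \<phi> p) =
      (?D, ?D * fst (snd (ode2_field \<psi> (r p))), ?D * snd (snd (ode2_field \<psi> (r p))))"
    using ode3_field_reduced_vars[OF assms] unfolding lie_deriv_def
    by (cases "r p") simp
  show ?thesis
    by (rule surj_R3I[OF linear_frechet_derivative[OF smooth_on_differentiable[OF smooth_reduced_vars p]] 1 2 3])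
      (use \<open>K \<noteq> 0\<close> nz in auto)
qed

end

section \<open>From prolonged fields to \<lambda>-prolongations\<close>

lemma open_image_jet1: "open M \<Longrightarrow> open (jet1 ` M)"
proof (rule open_surjective_linear_image[OF _ bounded_linear.linear[OF bounded_linear_jet1]])
  show "surj jet1"
    by (rule surjI[of _ "\<lambda>(x, u, u1). (x, u, u1, 0)"]) auto
qed

lemma open_image_base: "open N \<Longrightarrow> open (base ` N)"
proof (rule open_surjective_linear_image[OF _ bounded_linear.linear[OF bounded_linear_base]])
  show "surj base"
    by (rule surjI[of _ "\<lambda>(x, u). (x, u, 0)"]) (auto simp: base_def)
qed

context reduced_ode
begin

text \<open>Write (\<xi>, \<eta>) for \<open>vb\<close>. Then v y = \<xi>/s and the derivative of
  \<alpha>1 is \<eta>/s, so the prolongation formula gives the last component as s (D_y(\<eta>/s) -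
  w1 D_y(\<xi>/s)). Moving \<open>s\<close> through D_y produces - D_y s / s, and that is the value
  of \<open>l\<close>.\<close>

lemma inherited_pair_lambda_prol1:
  assumes v: "smooth_on U v" and s: "smooth_on U s" "\<And>p. p \<in> U \<Longrightarrow> s p \<noteq> 0"
    and inh: "inherited_pair M y \<alpha> g N \<psi> v s vb l" and p: "p \<in> M"
  shows "s (base (jet1 p)) *\<^sub>R lie_deriv (prol2 v) r p = lambda_prol1 vb l (r p)"
proof -
  let ?q = "jet1 p"
  let ?b = "\<lambda>q. (y (base q), alpha1 y \<alpha> q)"
  let ?s = "s (base ?q)" and ?D = "D1 y ?q" and ?w1 = "alpha2 y \<alpha> p"
  note q = jet1_in_Q[OF p]
  have nz: "?D \<noteq> 0" "?s \<noteq> 0" using q s(2)[OF in_U[OF q]] by (auto simp: Q_def)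
  \<comment> \<open>The push-forward relation is prescribed only over the first-order jets of
    \<open>M\<close>; as these form an open set, the identities drawn from it can be
    differentiated.\<close>
  have oQ: "open (jet1 ` M)" by (rule open_image_jet1[OF M(1)])
  have pq: "?q \<in> jet1 ` M" using p by blast
  have rN: "r p' \<in> N" if "p' \<in> M" for p'
    using red that by (auto simp: reduction_def)
  have "(\<lambda>(y, w, w1). (y, w)) = base" by (auto simp: fun_eq_iff base_def)
  then have vb: "smooth_on (base ` N) vb" and push:
    "\<And>q. q \<in> jet1 ` M \<Longrightarrow>
      lie_deriv (\<lambda>(x, u, u1). s (x, u) *\<^sub>R prol1 v (x, u, u1)) (drop_alpha1 \<circ> coords1 y \<alpha>) q =
        vb ((drop_alpha1 \<circ> coords1 y \<alpha>) q)"
    and l: "l (r p) = - lie_deriv (ode3_field (\<psi> \<circ> drop_alpha2)) (s \<circ> g \<circ> jet0) (coords2 y \<alpha> p)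
        / (s \<circ> g \<circ> jet0) (coords2 y \<alpha> p)"
    using inh p unfolding inherited_pair_def pushes_to_def by auto
  have drop: "drop_alpha1 \<circ> coords1 y \<alpha> = ?b"
    by (auto simp: fun_eq_iff base_def)
  have scale: "(\<lambda>(x, u, u1). s (x, u) *\<^sub>R prol1 v (x, u, u1)) = (\<lambda>q. s (base q) *\<^sub>R prol1 v q)"
    by (auto simp: fun_eq_iff base_def)
  have db: "frechet_derivative ?b (at q) h =
      (frechet_derivative y (at (base q)) (base h), frechet_derivative (alpha1 y \<alpha>) (at q) h)"
    and ddb: "?b differentiable (at q)" if "q \<in> Q" for q h
  proof -
    have d: "y differentiable (at (base q))" "alpha1 y \<alpha> differentiable (at q)"
      using smooth_on_differentiable smooth_y smooth_alpha1 that in_U by blast+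
    show "frechet_derivative ?b (at q) h =
      (frechet_derivative y (at (base q)) (base h), frechet_derivative (alpha1 y \<alpha>) (at q) h)"
      by (simp add: frechet_derivative_Pair d differentiable_compose_base
          frechet_derivative_compose_bounded_linear[where f = y, OF bounded_linear_base d(1)])
    show "?b differentiable (at q)"
      by (intro differentiable_Pair d differentiable_compose_base)
  qed
  have vbq: "s (base q) *\<^sub>R (lie_deriv v y (base q), lie_deriv (prol1 v) (alpha1 y \<alpha>) q) = vb (?b q)"
    if "q \<in> jet1 ` M" for q
  proof -
    have qQ: "q \<in> Q" using that jet1_in_Q by blast
    show ?thesis
      using push[OF that]
      unfolding drop scale lie_deriv_def linear_cmul[OF linear_frechet_derivative[OF ddb[OF qQ]]]
      by (simp add: db[OF qQ] base_prol1)
  qed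
  have comps: "lie_deriv v y (base q) = fst (vb (?b q)) / s (base q)"
      "lie_deriv (prol1 v) (alpha1 y \<alpha>) q = snd (vb (?b q)) / s (base q)" if "q \<in> jet1 ` M" for q
  proof -
    have "s (base q) \<noteq> 0" using that jet1_in_Q in_U s(2) by blast
    then show "lie_deriv v y (base q) = fst (vb (?b q)) / s (base q)"
      "lie_deriv (prol1 v) (alpha1 y \<alpha>) q = snd (vb (?b q)) / s (base q)"
      using vbq[OF that, symmetric] by simp_all
  qed
  \<comment> \<open>Quotient rule for D_x(f/s), with D_x f = (D_x y) D_y f because \<open>f\<close>
    is a function of (y, w).\<close>
  have quot: "D2 (\<lambda>q. f (?b q) / s (base q)) p = ?D * D1 f (r p) / ?s - f (?b ?q) * D1 s ?q / (?s * ?s)"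
    if f: "smooth_on (base ` N) f" for f :: "R2 \<Rightarrow> real"
  proof -
    have "?b ?q \<in> base ` N" using rN[OF p] base_reduced_vars by (metis image_eqI)
    then have df: "f differentiable (at (?b ?q))"
      using f smooth_on_differentiable by blast
    then have dfb: "(\<lambda>q. f (?b q)) differentiable (at ?q)"
      using ddb[OF q] differentiable_chain_at[of ?b ?q f] by (simp add: comp_def)
    have ds: "s differentiable (at (base ?q))"
      using s(1) in_U[OF q] smooth_on_differentiable by blast
    have "frechet_derivative ?b (at ?q) (1, snd (snd p)) = ?D *\<^sub>R (1, ?w1)"
    proof -
      have "base (1, snd (snd p)) = (1, snd (snd ?q))" by (cases p) (simp add: base_def)
      then show ?thesis
        using nz by (simp add: db[OF q] alpha2_eq) (simp add: D1_eq D2_eq)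
    qed
    then have "D2 (\<lambda>q. f (?b q)) p = ?D * D1 f (r p)"
      unfolding D2_eq D1_eq[of f] frechet_derivative_chain[OF ddb[OF q] df] base_reduced_vars
      using linear_frechet_derivative[OF df]
      by (simp add: linear_cmul reduced_vars_eq del: scaleR_Pair)
    then show ?thesis
      using nz D2_compose_base[OF ds] unfolding D2_eq
      by (simp add: frechet_derivative_divide dfb differentiable_compose_base[OF ds])
        (simp add: field_simps)
  qed
  have svb: "smooth_on (base ` N) (\<lambda>p. fst (vb p))" "smooth_on (base ` N) (\<lambda>p. snd (vb p))"
    using vb red open_image_base by (auto simp: reduction_def intro!: smooth_on_fst smooth_on_snd)
  have dvy: "lie_deriv v y differentiable (at (base ?q))"
    by (rule smooth_on_differentiable[OF smooth_on_lie_deriv[OF U smooth_y v] in_U[OF q]])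
  have 1: "D1 (lie_deriv v y) ?q = ?D * D1 (\<lambda>p. fst (vb p)) (r p) / ?s - fst (vb (?b ?q)) * D1 s ?q / (?s * ?s)"
    unfolding D2_compose_base[OF dvy, symmetric] quot[OF svb(1), symmetric]
    unfolding D2_eq by (subst frechet_derivative_cong_open[OF oQ pq comps(1)]) auto
  have 2: "D2 (lie_deriv (prol1 v) (alpha1 y \<alpha>)) p =
      ?D * D1 (\<lambda>p. snd (vb p)) (r p) / ?s - snd (vb (?b ?q)) * D1 s ?q / (?s * ?s)"
    unfolding quot[OF svb(2), symmetric]
    unfolding D2_eq by (subst frechet_derivative_cong_open[OF oQ pq comps(2)]) auto
  \<comment> \<open>In the variables (y, \<alpha>) the function \<open>s\<close> has order zero, so
    the field of the equation acts on it as D_y; the chain rule then supplies the factor D_x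
    y.\<close>
  have 3: "l (r p) = - D1 s ?q / (?D * ?s)"
  proof -
    let ?c = "(y (base ?q), \<alpha> (base ?q))"
    have g: "homeomorphism U V (\<lambda>p. (y p, \<alpha> p)) g" "smooth_on V g" "open V"
      using red by (auto simp: reduction_def diffeomorphism_between_def)
    have cV: "?c \<in> V" "g ?c = base ?q" "g ` V \<subseteq> U"
      using g(1) in_U[OF q] by (auto simp: homeomorphism_def)
    let ?sg = "\<lambda>p. s (g p)"
    have dsg: "?sg differentiable (at ?c)"
      by (rule smooth_on_differentiable[OF smooth_on_compose[OF g(3) s(1) g(2) cV(3)] cV(1)])
    have dc: "(\<lambda>p. (y p, \<alpha> p)) differentiable (at (base ?q))"
      by (rule smooth_on_differentiable[OF smooth_change in_U[OF q]])
    have "D1 s ?q = frechet_derivative (\<lambda>p. ?sg (y p, \<alpha> p)) (at (base ?q)) (1, snd (snd ?q))"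
      unfolding D1_eq using g(1)
      by (subst frechet_derivative_cong_open[OF U in_U[OF q], of s "\<lambda>p. ?sg (y p, \<alpha> p)"])
       (auto simp: homeomorphism_def)
    also have "\<dots> = frechet_derivative ?sg (at ?c) (?D, D1 \<alpha> ?q)"
      using smooth_on_differentiable[OF smooth_y in_U[OF q]] smooth_on_differentiable[OF smooth_alpha in_U[OF q]]
      by (simp add: frechet_derivative_chain[OF dc, of ?sg] dsg frechet_derivative_Pair D1_eq)
    also have "(?D, D1 \<alpha> ?q) = ?D *\<^sub>R (1, alpha1 y \<alpha> ?q)"
      using nz by (simp add: alpha1_eq)
    finally have D1s: "D1 s ?q = ?D * frechet_derivative ?sg (at ?c) (1, alpha1 y \<alpha> ?q)"
      by (simp only: linear_cmul[OF linear_frechet_derivative[OF dsg]] real_scaleR_def)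
    have c2: "base (jet1 (coords2 y \<alpha> p)) = ?c" "snd (snd (jet1 (coords2 y \<alpha> p))) = alpha1 y \<alpha> ?q"
      by (cases p; simp add: base_def)+
    have sgj: "s \<circ> g \<circ> jet0 = (\<lambda>p. ?sg (base (jet1 p)))"
      by (simp add: fun_eq_iff base_jet1)
    have dsg': "?sg differentiable (at (base (jet1 (coords2 y \<alpha> p))))" using dsg c2 by simp
    have "lie_deriv (ode3_field (\<psi> \<circ> drop_alpha2)) (\<lambda>p. ?sg (base (jet1 p))) (coords2 y \<alpha> p) =
        D1 ?sg (jet1 (coords2 y \<alpha> p))"
      by (simp only: lie_deriv_ode3_field_compose_jet1[of "\<lambda>q. ?sg (base q)", OF differentiable_compose_base[OF dsg']]
          D2_compose_base[OF dsg'])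
    also have "\<dots> = frechet_derivative ?sg (at ?c) (1, alpha1 y \<alpha> ?q)"
      by (simp only: D1_eq c2)
    finally show ?thesis
      unfolding l sgj using nz by (simp add: c2 cV D1s)
  qed
  have lp: "lambda_prol1 vb l (r p) = (fst (vb (?b ?q)), snd (vb (?b ?q)),
      (D1 (\<lambda>p. snd (vb p)) (r p) + l (r p) * snd (vb (?b ?q)))
      - (D1 (\<lambda>p. fst (vb p)) (r p) + l (r p) * fst (vb (?b ?q))) * ?w1)"
    by (simp add: reduced_vars_eq comp_def)
  show ?thesis
    unfolding prol2_reduced_vars[OF v q] prol2_alpha2[OF v q] comps[OF pq] lp 1 2 3
    using nz by (simp add: field_simps)
qed

section \<open>First integrals pulled back to the original jet space\<close>

lemma prol2_assoc_first_integral: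
  assumes "smooth_on U v" "smooth_on U s" "\<And>p. p \<in> U \<Longrightarrow> s p \<noteq> 0"
    and "inherited_pair M y \<alpha> g N \<psi> v s vb l" "assoc_first_integral N \<psi> vb l I" "p \<in> M"
  shows "lie_deriv (prol2 v) (I \<circ> r) p = 0"
proof -
  have N: "r p \<in> N" using red assms(6) by (auto simp: reduction_def)
  have I: "smooth_on N I" using assms(5) by (simp add: assoc_first_integral_def)
  note lin = linear_frechet_derivative[OF smooth_on_differentiable[OF I N]]
  have "s (base (jet1 p)) * lie_deriv (prol2 v) (I \<circ> r) p =
      frechet_derivative I (at (r p)) (s (base (jet1 p)) *\<^sub>R lie_deriv (prol2 v) r p)"
    by (simp add: lie_deriv_reduced[OF I assms(6)] linear_cmul[OF lin])
  also have "\<dots> = lie_deriv (lambda_prol1 vb l) I (r p)"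
    by (simp only: inherited_pair_lambda_prol1[OF assms(1-4,6)]) (simp only: lie_deriv_def)
  also have "\<dots> = 0"
    using assms(5) N by (simp add: assoc_first_integral_def)
  finally show ?thesis
    using assms(3)[OF in_U[OF jet1_in_Q[OF assms(6)]]] by simp
qed

lemma ode3_field_first_integral:
  assumes "assoc_first_integral N \<psi> vb l I" "p \<in> M"
  shows "lie_deriv (ode3_field \<phi>) (I \<circ> r) p = 0"
proof -
  have N: "r p \<in> N" using red assms(2) by (auto simp: reduction_def)
  have I: "smooth_on N I" using assms(1) by (simp add: assoc_first_integral_def)
  have "lie_deriv (ode3_field \<phi>) (I \<circ> r) p = D1 y (jet1 p) * lie_deriv (ode2_field \<psi>) I (r p)"
    unfolding lie_deriv_reduced[OF I assms(2)] ode3_field_reduced_vars[OF assms(2)]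
      linear_cmul[OF linear_frechet_derivative[OF smooth_on_differentiable[OF I N]]]
    by (simp add: lie_deriv_def)
  then show ?thesis
    using assms(1) N by (simp add: assoc_first_integral_def)
qed

lemma prol2_v3_first_integral:
  assumes "smooth_on N I" "p \<in> M"
  shows "lie_deriv (prol2 v3) (I \<circ> r) p = 0"
proof -
  have N: "r p \<in> N" using red assms(2) by (auto simp: reduction_def)
  show ?thesis
    using linear_0[OF linear_frechet_derivative[OF smooth_on_differentiable[OF assms(1) N]]]
    by (simp add: lie_deriv_reduced[OF assms] prol2_v3_reduced_vars[OF assms(2)])
qed

text \<open>If \<open>b\<close> were killed as well, the differential would vanish on a whole frame;
  as \<open>r\<close> is a submersion, the differential of \<open>I\<close> would then be zero at
  \<open>r p\<close>. The vectors \<open>a\<close> and \<open>b\<close> will be the two remaining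
  symmetries, in either order.\<close>

lemma first_integral_derivative_nonzero:
  assumes "assoc_first_integral N \<psi> vb l I" "p \<in> M"
    and frame: "lin_indep4 (ode3_field \<phi> p) a b (prol2 v3 p)"
    and a: "frechet_derivative (I \<circ> r) (at p) a = 0"
  shows "frechet_derivative (I \<circ> r) (at p) b \<noteq> 0"
proof
  assume b: "frechet_derivative (I \<circ> r) (at p) b = 0"
  have N: "r p \<in> N" using red assms(2) by (auto simp: reduction_def)
  have I: "smooth_on N I" using assms(1) by (simp add: assoc_first_integral_def)
  have "linear (frechet_derivative (I \<circ> r) (at p))"
    by (rule linear_frechet_derivative[OF smooth_on_differentiable[OF smooth_reduced[OF I] assms(2)]])
  from lin_indep4_frame[OF frame this _ a b] have "frechet_derivative (I \<circ> r) (at p) h = 0" for h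
    using ode3_field_first_integral[OF assms(1,2)] prol2_v3_first_integral[OF I assms(2)]
    unfolding lie_deriv_def by blast
  then have "frechet_derivative I (at (r p)) (frechet_derivative r (at p) h) = 0" for h
    using lie_deriv_reduced[OF I assms(2), of "\<lambda>_. h"] by (simp add: lie_deriv_def)
  then have "frechet_derivative I (at (r p)) z = 0" for z
    using surjD[OF surj_reduced_vars[OF assms(2)], of z] by (elim exE) (simp only:)
  then have "frechet_derivative I (at (r p)) = (\<lambda>_. 0)" ..
  then show False
    using assms(1) N by (simp add: assoc_first_integral_def)
qed

end

section \<open>Complete systems\<close>

lemma lie_deriv_reciprocal:
  fixes f :: "'a::real_normed_vector \<Rightarrow> real"
  assumes "f differentiable (at p)" "f p \<noteq> 0"
  shows "lie_deriv X (\<lambda>p. 1 / f p) p = - lie_deriv X f p / (f p * f p)"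
  using lie_deriv_divide[of "\<lambda>_. 1" p f X] assms by (simp add: lie_deriv_def)

text \<open>For \<open>I2\<close> the first two symmetries exchange roles.\<close>

lemma lin_indep4_swap: "lin_indep4 p q r s \<Longrightarrow> lin_indep4 p r q s"
  unfolding lin_indep4_def by (metis add.assoc add.commute)

text \<open>Surjectivity is asked of the triple of separate differentials, so that it can be checked
  entry by entry on the symmetry fields.\<close>

lemma complete_systemI:
  assumes M: "open M" and J: "smooth_on M J" "\<And>p. p \<in> M \<Longrightarrow> lie_deriv X J p = 0"
    and f: "smooth_on M f" "\<And>p. p \<in> M \<Longrightarrow> lie_deriv X f p = 0" "\<And>p. p \<in> M \<Longrightarrow> f p \<noteq> 0"
    and h: "smooth_on M h" "\<And>p. p \<in> M \<Longrightarrow> lie_deriv X h p = 0" "\<And>p. p \<in> M \<Longrightarrow> h p \<noteq> 0"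
    and surj: "\<And>B. open B \<Longrightarrow> B \<noteq> {} \<Longrightarrow> B \<subseteq> M \<Longrightarrow>
      \<exists>p\<in>B. surj (\<lambda>v. (frechet_derivative J (at p) v,
        frechet_derivative (\<lambda>p. 1 / f p) (at p) v, frechet_derivative (\<lambda>p. 1 / h p) (at p) v))"
  shows "complete_system M X J (\<lambda>p. 1 / f p) (\<lambda>p. 1 / h p)"
proof -
  have s: "smooth_on M (\<lambda>p. 1 / f p)" "smooth_on M (\<lambda>p. 1 / h p)"
    using f h by (auto intro: smooth_on_divide[OF M smooth_on_const])
  have "lie_deriv X (\<lambda>p. 1 / f p) p = 0" "lie_deriv X (\<lambda>p. 1 / h p) p = 0" if "p \<in> M" for p
    using f h that by (simp_all add: lie_deriv_reciprocal smooth_on_differentiable)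
  moreover have "functionally_independent_on M (\<lambda>p. (J p, 1 / f p, 1 / h p))"
  proof (rule functionally_independent_onI)
    show "smooth_on M (\<lambda>p. (J p, 1 / f p, 1 / h p))"
      by (intro smooth_on_Pair M J s)
    fix B assume B: "open B" "B \<noteq> {}" "B \<subseteq> M"
    from surj[OF B] obtain p where p: "p \<in> B" "surj (\<lambda>v. (frechet_derivative J (at p) v,
        frechet_derivative (\<lambda>p. 1 / f p) (at p) v, frechet_derivative (\<lambda>p. 1 / h p) (at p) v))" by blast
    have d: "J differentiable (at p)" "(\<lambda>p. 1 / f p) differentiable (at p)" "(\<lambda>p. 1 / h p) differentiable (at p)"
      using smooth_on_differentiable J(1) s p(1) B(3) by blast+
    show "\<exists>p\<in>B. surj (frechet_derivative (\<lambda>p. (J p, 1 / f p, 1 / h p)) (at p))"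
      using p by (intro bexI[of _ p]) (simp_all add: frechet_derivative_Pair[OF d(1) differentiable_Pair[OF d(2,3)]]
          frechet_derivative_Pair[OF d(2,3)])
  qed
  ultimately show ?thesis
    using J s by (simp add: complete_system_def)
qed

lemma lie_bracket_antisym: "lie_bracket X Y p = - lie_bracket Y X p"
  by (simp add: lie_bracket_def)

text \<open>The matrix shape arising for \<open>J1\<close>: subtracting a multiple of
  \<open>a\<close> from \<open>b\<close> clears the middle entry and leads back to the
  anti-triangular case.\<close>

lemma surj_R3I':
  fixes T :: "'a::real_vector \<Rightarrow> R3"
  assumes "linear T" "T a = (0, t1, 0)" "T b = (0, r1, t2)" "T c = (t3, r2, r3)"
    and "t1 \<noteq> 0" "t2 \<noteq> 0" "t3 \<noteq> 0"
  shows "surj T"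
proof (rule surj_R3I[OF assms(1) _ assms(2) assms(4)])
  show "T (b - (r1 / t1) *\<^sub>R a) = (0, 0, t2)"
    using assms by (simp add: linear_diff[OF assms(1)] linear_cmul[OF assms(1)])
qed (use assms in auto)

theorem mainTheorem5:
  fixes U V :: "(real \<times> real) set"
    and M :: "(real \<times> real \<times> real \<times> real) set"
    and N :: "(real \<times> real \<times> real) set"
    and \<phi> J1 J2 F1 F2 :: "real \<times> real \<times> real \<times> real \<Rightarrow> real"
    and v1 v2 v3 g vb1 vb2 :: "real \<times> real \<Rightarrow> real \<times> real"
    and y \<alpha> s1 s2 :: "real \<times> real \<Rightarrow> real"
    and \<psi> l1 l2 I1 I2 :: "real \<times> real \<times> real \<Rightarrow> real"
  assumes "open U" and "open M" and "jet0 ` M \<subseteq> U"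
    and "smooth_on M \<phi>"
    and "smooth_on U v1" and "smooth_on U v2" and "smooth_on U v3"
    and "lie_point_symmetry M \<phi> v1"
    and "lie_point_symmetry M \<phi> v2"
    and "lie_point_symmetry M \<phi> v3"
    and "sl2_basis_on U v1 v2 v3"
    and "\<And>p. p \<in> M \<Longrightarrow> lin_indep4 (ode3_field \<phi> p) (prol2 v1 p) (prol2 v2 p) (prol2 v3 p)"
    and "reduction U M \<phi> v3 V y \<alpha> g N \<psi>"
    and "smooth_on U s1" and "\<And>p. p \<in> U \<Longrightarrow> s1 p \<noteq> 0"
    and "\<And>p. p \<in> U \<Longrightarrow> lie_deriv v3 s1 p = s1 p"
    and "smooth_on U s2" and "\<And>p. p \<in> U \<Longrightarrow> s2 p \<noteq> 0"
    and "\<And>p. p \<in> U \<Longrightarrow> lie_deriv v3 s2 p = - s2 p"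
    and "inherited_pair M y \<alpha> g N \<psi> v1 s1 vb1 l1"
    and "inherited_pair M y \<alpha> g N \<psi> v2 s2 vb2 l2"
    and "assoc_first_integral N \<psi> vb1 l1 I1"
    and "assoc_first_integral N \<psi> vb2 l2 I2"
    and "J1 = I1 \<circ> reduced_vars y \<alpha>"
    and "J2 = I2 \<circ> reduced_vars y \<alpha>"
    and "F1 = (\<lambda>p. 1 / lie_deriv (prol2 v1) J2 p)"
    and "F2 = (\<lambda>p. 1 / lie_deriv (prol2 v2) J1 p)"
  shows "complete_system M (ode3_field \<phi>) J1 F1 F2 \<and>
         complete_system M (ode3_field \<phi>) J2 F1 F2"
proof -
  note asm = assms
  let ?A = "ode3_field \<phi>" and ?X1 = "prol2 v1" and ?X2 = "prol2 v2" and ?X3 = "prol2 v3"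
  have U: "open U" and M: "open M" and v: "smooth_on U v1" "smooth_on U v2" "smooth_on U v3"
    using asm by blast+
  interpret R: reduced_ode U V M N \<phi> v3 g y \<alpha> \<psi>
    using asm by unfold_locales
  have b: "base (jet1 p) \<in> U" if "p \<in> M" for p
    using R.in_U[OF R.jet1_in_Q[OF that]] .
  have X: "smooth_on M (prol2 w)" if "smooth_on U w" for w
    by (rule smooth_on_subset[OF smooth_on_prol2[OF U that]]) (use b in auto)
  note sX = X[OF v(1)] X[OF v(2)] X[OF v(3)]
  have sA: "smooth_on M ?A"
    unfolding ode3_field_eq
    by (intro smooth_on_Pair smooth_on_const smooth_on_fst smooth_on_snd smooth_on_ident M R.M(3))
  have br: "lie_bracket v1 v3 p = v1 p" "lie_bracket v1 v2 p = 2 *\<^sub>R v3 p" "lie_bracket v3 v2 p = v2 p"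
    if "p \<in> U" for p
    using \<open>sl2_basis_on U v1 v2 v3\<close> that by (auto simp: sl2_basis_on_def)
  have b13: "lie_bracket ?X1 ?X3 p = 1 *\<^sub>R ?X1 p"
    and b12: "lie_bracket ?X1 ?X2 p = 2 *\<^sub>R ?X3 p"
    and b32: "lie_bracket ?X3 ?X2 p = 1 *\<^sub>R ?X2 p" if "p \<in> M" for p
    using prol2_lie_bracket[OF U v(1,3) b[OF that]] prol2_lie_bracket[OF U v(1,2) b[OF that]]
      prol2_lie_bracket[OF U v(3,2) b[OF that]]
      prol2_cong[OF U br(1) b[OF that]] prol2_cong[OF U br(2) b[OF that]] prol2_cong[OF U br(3) b[OF that]]
      prol2_scaleR[OF U v(3) b[OF that]] by simp_all
  \<comment> \<open>For \<open>h\<close> the roles of \<open>v1\<close> and \<open>v2\<close> are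
    exchanged, which reverses the brackets: k = -2 and e = -1, against k = 2 and e = 1 for
    \<open>f\<close>.\<close>
  have b31: "lie_bracket ?X3 ?X1 p = (- 1) *\<^sub>R ?X1 p"
    and b21: "lie_bracket ?X2 ?X1 p = (- 2) *\<^sub>R ?X3 p" if "p \<in> M" for p
    using b13[OF that] b12[OF that] lie_bracket_antisym[of ?X3 ?X1 p] lie_bracket_antisym[of ?X2 ?X1 p]
    by simp_all
  note bA = lie_point_symmetry_bracket[OF U _ M \<open>smooth_on M \<phi>\<close> _ b]
  have I1: "assoc_first_integral N \<psi> vb1 l1 I1" and I2: "assoc_first_integral N \<psi> vb2 l2 I2"
    using asm by blast+
  then have sI: "smooth_on N I1" "smooth_on N I2" by (auto simp: assoc_first_integral_def)
  have J: "J1 = I1 \<circ> R.r" "J2 = I2 \<circ> R.r" using asm by blast+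
  have sJ: "smooth_on M J1" "smooth_on M J2"
    unfolding J by (intro R.smooth_reduced sI)+
  have AJ: "lie_deriv ?A J1 p = 0" "lie_deriv ?A J2 p = 0" if "p \<in> M" for p
    unfolding J using R.ode3_field_first_integral[OF I1 that] R.ode3_field_first_integral[OF I2 that] by auto
  have X3J: "lie_deriv ?X3 J1 p = 0" "lie_deriv ?X3 J2 p = 0" if "p \<in> M" for p
    unfolding J using R.prol2_v3_first_integral[OF sI(1) that] R.prol2_v3_first_integral[OF sI(2) that] by auto
  have X1J1: "lie_deriv ?X1 J1 p = 0" if "p \<in> M" for p
    unfolding J
    by (rule R.prol2_assoc_first_integral[OF v(1) \<open>smooth_on U s1\<close> _ \<open>inherited_pair M y \<alpha> g N \<psi> v1 s1 vb1 l1\<close> I1 that])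
      (use asm in blast)
  have X2J2: "lie_deriv ?X2 J2 p = 0" if "p \<in> M" for p
    unfolding J
    by (rule R.prol2_assoc_first_integral[OF v(2) \<open>smooth_on U s2\<close> _ \<open>inherited_pair M y \<alpha> g N \<psi> v2 s2 vb2 l2\<close> I2 that])
      (use asm in blast)
  define f where "f = lie_deriv ?X2 J1"
  define h where "h = lie_deriv ?X1 J2"
  have sfh: "smooth_on M f" "smooth_on M h"
    unfolding f_def h_def by (intro smooth_on_lie_deriv M sJ sX)+
  have frame: "lin_indep4 (?A p) (?X1 p) (?X2 p) (?X3 p)" if "p \<in> M" for p
    using asm that by blast
  have f0: "f p \<noteq> 0" if "p \<in> M" for p
    using R.first_integral_derivative_nonzero[OF I1 that frame[OF that]] X1J1[OF that]
    by (simp add: f_def lie_deriv_def J)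
  have h0: "h p \<noteq> 0" if "p \<in> M" for p
    using R.first_integral_derivative_nonzero[OF I2 that lin_indep4_swap[OF frame[OF that]]] X2J2[OF that]
    by (simp add: h_def lie_deriv_def J)
  note f_eigen = lie_deriv_eigenfunction[OF M sJ(1) sX(1,2,3) sA AJ(1) X1J1 X3J(1)
      bA[OF v(2) _ _ \<open>lie_point_symmetry M \<phi> v2\<close>] b12 b32, folded f_def]
  note h_eigen = lie_deriv_eigenfunction[OF M sJ(2) sX(2,1,3) sA AJ(2) X2J2 X3J(2)
      bA[OF v(1) _ _ \<open>lie_point_symmetry M \<phi> v1\<close>] b21 b31, folded h_def]
  have ef: "lie_deriv ?A f p = 0" "lie_deriv ?X1 f p = 0" "lie_deriv ?X3 f p = f p"
    and eh: "lie_deriv ?A h p = 0" "lie_deriv ?X2 h p = 0" "lie_deriv ?X3 h p = - h p" if "p \<in> M" for p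
    using f_eigen(1-3) h_eigen(1-3) that by simp_all
  have F: "F1 = (\<lambda>p. 1 / h p)" "F2 = (\<lambda>p. 1 / f p)"
    using asm by (auto simp: f_def h_def)
  have lin: "linear (\<lambda>v. (frechet_derivative J (at p) v,
        frechet_derivative (\<lambda>p. 1 / h p) (at p) v, frechet_derivative (\<lambda>p. 1 / f p) (at p) v))"
    if "smooth_on M J" "p \<in> M" for J :: "R4 \<Rightarrow> real" and p
  proof -
    have s: "smooth_on M (\<lambda>p. 1 / f p)" "smooth_on M (\<lambda>p. 1 / h p)"
      using f0 h0 sfh by (auto intro: smooth_on_divide[OF M smooth_on_const])
    note bl = has_derivative_bounded_linear[OF smooth_on_has_derivative[OF _ that(2)]]
    show ?thesis
      by (rule bounded_linear.linear[OF bounded_linear_Pair[OF bl[OF that(1)] bounded_linear_Pair[OF bl[OF s(2)] bl[OF s(1)]]]])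
  qed
  have rec: "frechet_derivative (\<lambda>p. 1 / f p) (at p) (Y p) = - lie_deriv Y f p / (f p * f p)"
    "frechet_derivative (\<lambda>p. 1 / h p) (at p) (Y p) = - lie_deriv Y h p / (h p * h p)" if "p \<in> M" for p Y
    using lie_deriv_reciprocal[OF smooth_on_differentiable[OF sfh(1) that] f0[OF that], of Y]
      lie_deriv_reciprocal[OF smooth_on_differentiable[OF sfh(2) that] h0[OF that], of Y]
    by (simp_all add: lie_deriv_def)
  have "complete_system M ?A J1 F1 F2"
    unfolding F
  proof (rule complete_systemI[OF M sJ(1) AJ(1) sfh(2) eh(1) h0 sfh(1) ef(1) f0])
    fix B assume B: "open B" "B \<noteq> {}" "B \<subseteq> M"
    \<comment> \<open>\<open>X1 h\<close> may have zeros, but it cannot vanish on all of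
      \<open>B\<close>.\<close>
    obtain p where p: "p \<in> B" "lie_deriv ?X1 h p \<noteq> 0"
      using h_eigen(4)[where B = B] h0 B by auto
    with B have pM: "p \<in> M" by blast
    have "surj (\<lambda>v. (frechet_derivative J1 (at p) v,
        frechet_derivative (\<lambda>p. 1 / h p) (at p) v, frechet_derivative (\<lambda>p. 1 / f p) (at p) v))"
    \<comment> \<open>\<open>X1\<close> kills \<open>J1\<close> and \<open>f\<close>,
      \<open>X3\<close> kills \<open>J1\<close> and scales \<open>f\<close>, and
      \<open>X2 J1 = f\<close>; the decisive entries are multiples of \<open>X1 h\<close>,
      \<open>1 / f\<close> and \<open>f\<close>.\<close>
    proof (rule surj_R3I'[OF lin[OF sJ(1) pM], of "?X1 p" _ "?X3 p" _ _ "?X2 p"])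
      show "(frechet_derivative J1 (at p) (?X1 p), frechet_derivative (\<lambda>p. 1 / h p) (at p) (?X1 p),
          frechet_derivative (\<lambda>p. 1 / f p) (at p) (?X1 p)) = (0, - lie_deriv ?X1 h p / (h p * h p), 0)"
        using X1J1[OF pM] by (simp add: rec[OF pM] ef(2)[OF pM]) (simp add: lie_deriv_def)
      show "(frechet_derivative J1 (at p) (?X3 p), frechet_derivative (\<lambda>p. 1 / h p) (at p) (?X3 p),
          frechet_derivative (\<lambda>p. 1 / f p) (at p) (?X3 p)) =
          (0, - lie_deriv ?X3 h p / (h p * h p), - 1 / f p)"
        using X3J(1)[OF pM] by (simp add: rec[OF pM] ef(3)[OF pM]) (simp add: lie_deriv_def)
      show "(frechet_derivative J1 (at p) (?X2 p), frechet_derivative (\<lambda>p. 1 / h p) (at p) (?X2 p),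
          frechet_derivative (\<lambda>p. 1 / f p) (at p) (?X2 p)) =
          (f p, - lie_deriv ?X2 h p / (h p * h p), - lie_deriv ?X2 f p / (f p * f p))"
        by (simp add: rec[OF pM]) (simp add: f_def lie_deriv_def)
    qed (use p(2) f0[OF pM] h0[OF pM] in auto)
    with p(1) show "\<exists>p\<in>B. surj (\<lambda>v. (frechet_derivative J1 (at p) v,
        frechet_derivative (\<lambda>p. 1 / h p) (at p) v, frechet_derivative (\<lambda>p. 1 / f p) (at p) v))" ..
  qed
  moreover have "complete_system M ?A J2 F1 F2"
    unfolding F
  proof (rule complete_systemI[OF M sJ(2) AJ(2) sfh(2) eh(1) h0 sfh(1) ef(1) f0])
    fix B assume B: "open B" "B \<noteq> {}" "B \<subseteq> M"
    obtain p where p: "p \<in> B" "lie_deriv ?X2 f p \<noteq> 0"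
      using f_eigen(4)[where B = B] f0 B by auto
    with B have pM: "p \<in> M" by blast
    have "surj (\<lambda>v. (frechet_derivative J2 (at p) v,
        frechet_derivative (\<lambda>p. 1 / h p) (at p) v, frechet_derivative (\<lambda>p. 1 / f p) (at p) v))"
    \<comment> \<open>\<open>X2\<close> kills \<open>J2\<close> and \<open>h\<close>, so only
      \<open>1 / f\<close> varies along it; with \<open>X3\<close> and \<open>X1\<close> next, the
      shape is anti-triangular, with entries from \<open>X2 f\<close>, \<open>1 / h\<close> and
      \<open>h\<close>.\<close>
    proof (rule surj_R3I[OF lin[OF sJ(2) pM], of "?X2 p" _ "?X3 p" _ _ "?X1 p"])
      show "(frechet_derivative J2 (at p) (?X2 p), frechet_derivative (\<lambda>p. 1 / h p) (at p) (?X2 p),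
          frechet_derivative (\<lambda>p. 1 / f p) (at p) (?X2 p)) = (0, 0, - lie_deriv ?X2 f p / (f p * f p))"
        using X2J2[OF pM] by (simp add: rec[OF pM] eh(2)[OF pM]) (simp add: lie_deriv_def)
      show "(frechet_derivative J2 (at p) (?X3 p), frechet_derivative (\<lambda>p. 1 / h p) (at p) (?X3 p),
          frechet_derivative (\<lambda>p. 1 / f p) (at p) (?X3 p)) =
          (0, 1 / h p, - lie_deriv ?X3 f p / (f p * f p))"
        using X3J(2)[OF pM] by (simp add: rec[OF pM] eh(3)[OF pM]) (simp add: lie_deriv_def)
      show "(frechet_derivative J2 (at p) (?X1 p), frechet_derivative (\<lambda>p. 1 / h p) (at p) (?X1 p),
          frechet_derivative (\<lambda>p. 1 / f p) (at p) (?X1 p)) =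
          (h p, - lie_deriv ?X1 h p / (h p * h p), - lie_deriv ?X1 f p / (f p * f p))"
        by (simp add: rec[OF pM]) (simp add: h_def lie_deriv_def)
    qed (use p(2) f0[OF pM] h0[OF pM] in auto)
    with p(1) show "\<exists>p\<in>B. surj (\<lambda>v. (frechet_derivative J2 (at p) v,
        frechet_derivative (\<lambda>p. 1 / h p) (at p) v, frechet_derivative (\<lambda>p. 1 / f p) (at p) v))" ..
  qed
  ultimately show ?thesis ..
qed

end
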